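(* Consider the linear recursion setting below with any fixed (deterministic) initial condition $e(0)$, and suppose Assumption 3 holds. Then $\lim_{t\to\infty}\mathbb{E}\{\|e(t)\|^2\}=0$. If in addition (a) $\sum_{t=1}^\infty\alpha(t)^{2(1-\delta)}<\infty$ with $\delta$ from Assumption 3 (iii.a), (b) $\sum_{t=1}^\infty\alpha(t)g_2(t)<\infty$, and (c) $\varepsilon'(t)=u(t)w(t)$ with $u(t)\in\mathbb{R}^{q\times q}$, $w(t)\in\mathbb{R}^q$, where $\{w(t)\}$ is independent of $\{Q(t),\Delta(t),u(t)\}$ and $\{w(t),\mathcal{F}(t)\}$ is a martingale difference sequence, then $\mathbb{P}\{\lim_{t\to\infty}e(t)=0\}=1$.
   Context: Linear recursion setting: $e(t+1)=e(t)+\alpha(t)(Q(t)+\Delta(t))e(t)+\alpha(t)(\varepsilon'(t)+\varepsilon''(t))$, $t\in\mathbb{N}$, with $e(t),\varepsilon'(t),\varepsilon''(t)\in\mathbb{R}^q$, random $Q(t),\Delta(t)\in\mathbb{R}^{q\times q}$, and deterministic scalar step size $\alpha(t)$. $\mathcal{F}(t)=\sigma(Q(s),\Delta(s),\varepsilon'(s),0\le s\le t)$, $\mathcal{F}(-1)=\{\emptyset,\Omega\}$. Assumption 3: (i) $\alpha(t)>0$, $\alpha(t)\to0$, $\sum_t\alpha(t)=\infty$, $1/\alpha(t+1)-1/\alpha(t)\to\alpha_0\ge0$. (ii.a) $\sup_t\|Q(t)\|\le\pi_1<\infty$ a.s., and there exist $h\in\mathbb{N}^+$, $\lambda>0$ with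 $\lambda_{\max}\big[\sum_{t=mh}^{(m+1)h-1}\mathbb{E}\{Q(t)+Q^{\sf T}(t)\mid\mathcal{F}(mh-1)\}\big]\le-\lambda$ a.s. for all $m\in\mathbb{N}$. (ii.b) $\|\Delta(t)\|\le g_1(t)$ a.s., where $g_1$ is a deterministic measurable function with $g_1(t)\to0$ and $\sup_{t\ge0}g_1(t)<\infty$. (iii.a) $\{\varepsilon'(t),\mathcal{F}(t)\}$ is a martingale difference sequence and $\sup_t\mathbb{E}\{\|\alpha^\delta(t)\varepsilon'(t)\|^2\mid\mathcal{F}(t-1)\}\le c_\varepsilon$ a.s. for a constant $c_\varepsilon>0$ and some $\delta\in[0,1/2)$. (iii.b) $\varepsilon''(t)$ is $\mathcal{F}(t)$-measurable and $\|\varepsilon''(t)\|\le g_2(t)$ a.s., where $g_2$ is a deterministic measurable function with $g_2(t)\to0$ and $\sup_{t\ge0}g_2(t)<\infty$. *)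

theory Defs
  imports "HOL-Probability.Probability"
begin

definition gen_events :: "'a measure \<Rightarrow> ('i \<Rightarrow> 'a \<Rightarrow> 'b::topological_space) \<Rightarrow> 'i set \<Rightarrow> 'a set set" where
  "gen_events M X I = (\<Union>s\<in>I. {X s -` A \<inter> space M | A. A \<in> sets borel})"

text \<open>The filtration F(t) = sigma(Q(s), Delta(s), eps'(s), 0 <= s <= t), indexed by an integer t;
  F(-1) is the trivial sigma-algebra.\<close>
definition filtr :: "'a measure \<Rightarrow> (nat \<Rightarrow> 'a \<Rightarrow> real^'q^'q) \<Rightarrow> (nat \<Rightarrow> 'a \<Rightarrow> real^'q^'q)
    \<Rightarrow> (nat \<Rightarrow> 'a \<Rightarrow> real^'q) \<Rightarrow> int \<Rightarrow> 'a measure" where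
  "filtr M Q D E t = sigma (space M)
     (gen_events M Q {s. int s \<le> t} \<union> gen_events M D {s. int s \<le> t} \<union> gen_events M E {s. int s \<le> t})"

definition cond_exp_mat :: "'a measure \<Rightarrow> 'a measure \<Rightarrow> ('a \<Rightarrow> real^'n^'m) \<Rightarrow> 'a \<Rightarrow> real^'n^'m" where
  "cond_exp_mat M F A \<omega> = (\<chi> i j. real_cond_exp M F (\<lambda>x. A x $ i $ j) \<omega>)"

definition cond_exp_vec :: "'a measure \<Rightarrow> 'a measure \<Rightarrow> ('a \<Rightarrow> real^'n) \<Rightarrow> 'a \<Rightarrow> real^'n" where
  "cond_exp_vec M F v \<omega> = (\<chi> i. real_cond_exp M F (\<lambda>x. v x $ i) \<omega>)"

text \<open>Largest (real) eigenvalue of a square real matrix (used for symmetric matrices).\<close>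
definition lambda_max :: "real^'n^'n \<Rightarrow> real" where
  "lambda_max A = Max {l. \<exists>x. x \<noteq> 0 \<and> A *v x = l *\<^sub>R x}"

definition mnorm :: "real^'n^'m \<Rightarrow> real" where
  "mnorm A = onorm (\<lambda>x. A *v x)"

end

theory Submission
  imports Defs
begin

text \<open>Sample the recursion at the block starts \<open>m * h\<close> and write \<open>V m\<close> for the squared norm of \<open>e (m * h)\<close>.
  Expanding one block to first order in the step size \<open>a = \<alpha> (m * h)\<close> gives, pathwise,
  \<open>V (m + 1) \<le> V m + 2 a x \<bullet> (\<Sum>Q) x + (martingale term) + o(a) (V m + 1) + O(\<Sum> \<alpha>\<^sup>2 |\<epsilon>'|\<^sup>2)\<close> with \<open>x = e (m * h)\<close>.
  Integrating over an event \<open>A\<close> of \<open>F(m h - 1)\<close> kills the martingale term, and the eigenvalue condition bounds the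
  quadratic one by \<open>- lam a V m\<close>. So eventually \<open>E[V (m + 1); A] \<le> (1 - a lam / 2) E[V m; A] + \<gamma> m\<close> with
  \<open>\<gamma> m = o(a)\<close>, and \<open>A = \<Omega>\<close> gives mean square convergence because the step sizes are not summable.
  If \<open>\<alpha>\<close> to the power \<open>2 (1 - \<delta>)\<close> and \<open>\<alpha> g2\<close> are summable, then so is \<open>\<gamma>\<close>, and \<open>V\<close> is a nonnegative
  supermartingale up to a summable error whose mean tends to 0; the maximal inequality then yields almost sure
  convergence along the block starts. Inside a block \<open>e\<close> is controlled by \<open>V m\<close> and by \<open>\<Sum> \<alpha>\<^sup>2 |\<epsilon>'|\<^sup>2\<close>, which
  has summable means.\<close>

section \<open>Step sizes and scalar recursions\<close>

text \<open>The ratio \<open>\<alpha> t / \<alpha> (Suc t)\<close> is 1 plus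
  \<open>\<alpha> t\<close> times a convergent, hence bounded, increment, so it tends to 1, and
  \<open>k\<close> such ratios multiply to the general case. Step sizes therefore count as constant
  over a block, up to a vanishing relative error.\<close>

lemma step_ratio_tendsto_1:
  fixes \<alpha> :: "nat \<Rightarrow> real"
  assumes pos: "\<And>t. \<alpha> t > 0" and lim: "\<alpha> \<longlonglongrightarrow> 0"
    and inv: "(\<lambda>t. 1 / \<alpha> (Suc t) - 1 / \<alpha> t) \<longlonglongrightarrow> l"
  shows "(\<lambda>t. \<alpha> (t + k) / \<alpha> t) \<longlonglongrightarrow> 1"
proof (induction k)
  case 0
  have "\<alpha> t \<noteq> 0" for t using pos[of t] by simp
  then show ?case by simp
next
  case (Suc k)
  have "(\<lambda>t. 1 + \<alpha> t * (1 / \<alpha> (Suc t) - 1 / \<alpha> t)) \<longlonglongrightarrow> 1 + 0 * l"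
    by (intro tendsto_intros lim inv)
  moreover have "1 + \<alpha> t * (1 / \<alpha> (Suc t) - 1 / \<alpha> t) = \<alpha> t / \<alpha> (Suc t)" for t
    using pos[of t] pos[of "Suc t"] by (simp add: field_simps)
  ultimately have "(\<lambda>t. \<alpha> t / \<alpha> (Suc t)) \<longlonglongrightarrow> 1" by simp
  from tendsto_inverse[OF this] have "(\<lambda>t. \<alpha> (Suc t) / \<alpha> t) \<longlonglongrightarrow> 1" by simp
  from LIMSEQ_ignore_initial_segment[OF this, of k]
  have "(\<lambda>t. \<alpha> (Suc (t + k)) / \<alpha> (t + k)) \<longlonglongrightarrow> 1" .
  from tendsto_mult[OF this Suc.IH]
  have "(\<lambda>t. \<alpha> (Suc (t + k)) / \<alpha> (t + k) * (\<alpha> (t + k) / \<alpha> t)) \<longlonglongrightarrow> 1" by simp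
  moreover have "\<alpha> (Suc (t + k)) / \<alpha> (t + k) * (\<alpha> (t + k) / \<alpha> t) = \<alpha> (t + Suc k) / \<alpha> t" for t
    using less_imp_neq[OF pos[of "t + k"]] by simp
  ultimately show ?case by (simp only:)
qed

lemma sum_nat_blocks:
  fixes f :: "nat \<Rightarrow> 'b::comm_monoid_add"
  shows "(\<Sum>m<n. \<Sum>k<h. f (m * h + k)) = sum f {..<n * h}"
proof -
  have "(\<Sum>k<h. f (m * h + k)) = sum f {m * h..<m * h + h}" for m
    using sum.shift_bounds_nat_ivl[of f 0 "m * h" h] by (simp add: lessThan_atLeast0 add.commute)
  then show ?thesis by (simp add: sum.nat_group)
qed

text \<open>For nonnegative terms summability is boundedness of partial sums, and the partial sums
  of the block sums are partial sums of \<open>f\<close> at multiples of \<open>h\<close>.\<close>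

lemma summable_blocks:
  fixes f :: "nat \<Rightarrow> real"
  assumes f: "\<And>t. f t \<ge> 0" and h: "h > 0"
  shows "summable (\<lambda>m. \<Sum>k<h. f (m * h + k)) \<longleftrightarrow> summable f"
proof
  assume *: "summable (\<lambda>m. \<Sum>k<h. f (m * h + k))"
  show "summable f"
  proof (rule bounded_imp_summable[OF f])
    fix n
    have "sum f {..n} \<le> sum f {..<Suc n * h}"
    proof (intro sum_mono2 f)
      have "Suc n * 1 \<le> Suc n * h" using h by (intro mult_le_mono2) simp
      then show "{..n} \<subseteq> {..<Suc n * h}" by auto
    qed auto
    also have "\<dots> = (\<Sum>m<Suc n. \<Sum>k<h. f (m * h + k))"
      by (rule sum_nat_blocks[symmetric])
    also have "\<dots> \<le> (\<Sum>m. \<Sum>k<h. f (m * h + k))"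
      by (rule sum_le_suminf[OF *]) (auto intro: sum_nonneg f)
    finally show "sum f {..n} \<le> (\<Sum>m. \<Sum>k<h. f (m * h + k))" .
  qed
next
  assume *: "summable f"
  show "summable (\<lambda>m. \<Sum>k<h. f (m * h + k))"
  proof (rule bounded_imp_summable)
    show "0 \<le> (\<Sum>k<h. f (m * h + k))" for m by (intro sum_nonneg f)
    fix n
    have "(\<Sum>m\<le>n. \<Sum>k<h. f (m * h + k)) = sum f {..<Suc n * h}"
      by (simp only: lessThan_Suc_atMost[symmetric] sum_nat_blocks)
    also have "\<dots> \<le> suminf f"
      by (rule sum_le_suminf[OF *]) (auto intro: f)
    finally show "(\<Sum>m\<le>n. \<Sum>k<h. f (m * h + k)) \<le> suminf f" .
  qed
qed

text \<open>Once \<open>\<zeta> m\<close> is below a level, the excess of \<open>U\<close> over that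
  level is multiplied by at most \<open>1 - b m\<close> in each step. A positive limit of the excess
  would bound \<open>b\<close> by a telescoping summable sequence.\<close>

lemma damped_recursion_tendsto_0:
  fixes U b \<zeta> :: "nat \<Rightarrow> real"
  assumes U: "\<And>m. U m \<ge> 0" and b: "\<And>m. b m \<ge> 0" "\<forall>\<^sub>F m in sequentially. b m \<le> 1"
    and nsum: "\<not> summable b" and \<zeta>: "\<zeta> \<longlonglongrightarrow> 0"
    and rec: "\<forall>\<^sub>F m in sequentially. U (Suc m) \<le> (1 - b m) * U m + b m * \<zeta> m"
  shows "U \<longlonglongrightarrow> 0"
proof (rule LIMSEQ_I)
  fix r :: real assume r: "r > 0"
  define \<epsilon> where "\<epsilon> = r / 2"
  have \<epsilon>: "\<epsilon> > 0" using r by (simp add: \<epsilon>_def)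
  have "\<forall>\<^sub>F m in sequentially. \<zeta> m < \<epsilon>" using order_tendstoD(2)[OF \<zeta> \<epsilon>] .
  with rec b(2) have "\<forall>\<^sub>F m in sequentially. b m \<le> 1 \<and> \<zeta> m < \<epsilon> \<and> U (Suc m) \<le> (1 - b m) * U m + b m * \<zeta> m"
    by eventually_elim simp
  then obtain N where N: "\<And>m. m \<ge> N \<Longrightarrow> b m \<le> 1 \<and> \<zeta> m < \<epsilon> \<and> U (Suc m) \<le> (1 - b m) * U m + b m * \<zeta> m"
    by (auto simp: eventually_sequentially)
  \<comment> \<open>Truncating the excess at 0 keeps it nonnegative when \<open>U\<close> falls
    below the level, which makes it monotone.\<close>
  define W where "W m = max (U (m + N) - \<epsilon>) 0" for m
  have W0: "W m \<ge> 0" for m by (simp add: W_def)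
  have step: "W (Suc m) \<le> (1 - b (m + N)) * W m" for m
  proof -
    have 1: "b (m + N) \<le> 1" "\<zeta> (m + N) \<le> \<epsilon>"
      "U (Suc (m + N)) \<le> (1 - b (m + N)) * U (m + N) + b (m + N) * \<zeta> (m + N)"
      using N[of "m + N"] by auto
    have "b (m + N) * \<zeta> (m + N) \<le> b (m + N) * \<epsilon>" by (intro mult_left_mono 1 b)
    then have "U (Suc (m + N)) - \<epsilon> \<le> (1 - b (m + N)) * (U (m + N) - \<epsilon>)"
      using 1(3) by (simp add: algebra_simps)
    also have "\<dots> \<le> (1 - b (m + N)) * W m"
      using 1 by (intro mult_left_mono) (auto simp: W_def)
    finally have "U (Suc (m + N)) - \<epsilon> \<le> (1 - b (m + N)) * W m" .
    moreover have "0 \<le> (1 - b (m + N)) * W m" using 1 W0 by simp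
    ultimately show ?thesis by (simp add: W_def)
  qed
  have dec: "W (Suc m) \<le> W m" for m
  proof -
    have "0 \<le> b (m + N) * W m" using b W0 by simp
    then show ?thesis using step[of m] by (simp add: algebra_simps)
  qed
  then have decW: "decseq W" by (simp add: decseq_Suc_iff)
  obtain L where L: "W \<longlonglongrightarrow> L" "\<And>i. L \<le> W i"
    using decseq_convergent[OF decW, of 0] W0 by auto
  have "L \<ge> 0" using LIMSEQ_le_const[OF L(1), of 0] W0 by auto
  have "L = 0"
  proof (rule ccontr)
    assume "L \<noteq> 0"
    with \<open>L \<ge> 0\<close> have Lpos: "L > 0" by simp
    have "summable (\<lambda>m. W m - W (Suc m))" using telescope_summable'[OF L(1)] .
    moreover have "norm (b (m + N) * L) \<le> W m - W (Suc m)" for m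
    proof -
      have "b (m + N) * L \<le> b (m + N) * W m" by (intro mult_left_mono L b)
      also have "\<dots> \<le> W m - W (Suc m)" using step[of m] by (simp add: algebra_simps)
      finally show ?thesis using b(1)[of "m + N"] Lpos by simp
    qed
    ultimately have "summable (\<lambda>m. b (m + N) * L)"
      by (rule summable_comparison_test'[where N = 0])
    then have "summable (\<lambda>m. b (m + N) * L * (1 / L))" by (rule summable_mult2)
    then have "summable (\<lambda>m. b (m + N))" using Lpos by simp
    then show False using nsum summable_iff_shift[of b N] by simp
  qed
  then have "\<forall>\<^sub>F m in sequentially. W m < \<epsilon>" using order_tendstoD(2)[OF L(1)] \<epsilon> by simp
  then obtain M where M: "\<And>m. m \<ge> M \<Longrightarrow> W m < \<epsilon>" by (auto simp: eventually_sequentially)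
  show "\<exists>no. \<forall>n\<ge>no. norm (U n - 0) < r"
  proof (intro exI allI impI)
    fix n assume "n \<ge> M + N"
    then have "W (n - N) < \<epsilon>" "n - N + N = n" using M[of "n - N"] by auto
    then have "U n < r" using r by (auto simp: W_def \<epsilon>_def max_def split: if_splits)
    then show "norm (U n - 0) < r" using U[of n] by simp
  qed
qed

lemma sum_squared_le_card:
  fixes f :: "nat \<Rightarrow> real"
  shows "(\<Sum>k<n. f k)\<^sup>2 \<le> real n * (\<Sum>k<n. (f k)\<^sup>2)"
proof -
  have "(\<Sum>k<n. 1 * f k)\<^sup>2 \<le> (\<Sum>k<n. 1\<^sup>2) * (\<Sum>k<n. (f k)\<^sup>2)"
    by (rule Cauchy_Schwarz_ineq_sum)
  then show ?thesis by simp
qed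

lemma square_sum3_le:
  fixes x y z :: real
  shows "(x + y + z)\<^sup>2 \<le> 3 * (x\<^sup>2 + y\<^sup>2 + z\<^sup>2)"
  using sum_squares_bound[of x y] sum_squares_bound[of y z] sum_squares_bound[of x z]
  by (simp add: power2_eq_square algebra_simps)

section \<open>One block of a perturbed linear recursion\<close>

text \<open>A discrete Gronwall constant: each of the \<open>h\<close> steps amplifies the
  displacement by at most \<open>1 + 2 * K\<close>, because \<open>a' k \<le> 2 * a \<le> 2\<close>.
  The last factor majorises the coefficients of the forcing terms.\<close>

definition growth_const :: "real \<Rightarrow> nat \<Rightarrow> real" where
  "growth_const K h = (1 + 2 * K) ^ h * (2 * K * real h + 2 * real h + 1)"

lemma growth_const_ge_1: "growth_const K h \<ge> 1" if "K \<ge> 0"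
proof -
  have "1 \<le> (1 + 2 * K) ^ h" using that by (intro one_le_power) simp
  moreover have "1 \<le> 2 * K * real h + 2 * real h + 1" using that by simp
  ultimately show ?thesis unfolding growth_const_def using mult_mono[of 1 _ 1] by fastforce
qed

text \<open>Chosen to dominate all five coefficients that appear in \<open>rest_le\<close>.\<close>

definition rest_const :: "real \<Rightarrow> nat \<Rightarrow> real" where
  "rest_const K h = 2 * real h * (K * growth_const K h + 1) + real h * K + 1"

text \<open>The first summand pays for the inner product of the initial state with the remainder,
  the second for the square of the whole increment. The factor \<open>1 + G\<close> allows
  \<open>(a * \<rho>)\<^sup>2\<close> to be replaced by a multiple of
  \<open>a * \<rho>\<close>.\<close>

definition expansion_const :: "real \<Rightarrow> nat \<Rightarrow> real \<Rightarrow> real" where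
  "expansion_const K h G
     = 4 * rest_const K h + 3 * (real h * K + 1 + rest_const K h * (3 + K))\<^sup>2 * (1 + G)"

text \<open>\<open>a\<close> is the step size at the start of the block and \<open>C k\<close> is the part of \<open>B k\<close> that is kept in
  the first order expansion.\<close>

locale perturbed_block =
  fixes B C :: "nat \<Rightarrow> 'v::real_inner \<Rightarrow> 'v" and y p r :: "nat \<Rightarrow> 'v"
    and a' :: "nat \<Rightarrow> real" and a g \<eta> \<rho> K :: real and h :: nat
  assumes rec: "\<And>k. k < h \<Longrightarrow> y (Suc k) = y k + a' k *\<^sub>R (B k (y k) + p k + r k)"
    and lin: "\<And>k. k < h \<Longrightarrow> linear (B k)"
    and B_le: "\<And>k z. k < h \<Longrightarrow> norm (B k z) \<le> K * norm z"
    and C_le: "\<And>k z. k < h \<Longrightarrow> norm (C k z) \<le> K * norm z"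
    and BC_le: "\<And>k z. k < h \<Longrightarrow> norm (B k z - C k z) \<le> g * norm z"
    and a'_nonneg: "\<And>k. k < h \<Longrightarrow> 0 \<le> a' k" and a'_le: "\<And>k. k < h \<Longrightarrow> a' k \<le> 2 * a"
    and a'_diff: "\<And>k. k < h \<Longrightarrow> \<bar>a' k - a\<bar> \<le> \<eta> * a"
    and r_le: "\<And>k. k < h \<Longrightarrow> norm (r k) \<le> \<rho>"
    and a01: "0 \<le> a" "a \<le> 1" and K: "0 \<le> K" and \<rho>: "0 \<le> \<rho>" and g: "0 \<le> g" "g \<le> K"
    and \<eta>: "0 \<le> \<eta>" "\<eta> \<le> 1"
begin

definition "P = (\<Sum>k<h. a' k * norm (p k))"

lemma P_nonneg: "P \<ge> 0"
  unfolding P_def by (intro sum_nonneg mult_nonneg_nonneg a'_nonneg) auto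

lemma P_squared_le: "P\<^sup>2 \<le> real h * (\<Sum>k<h. (a' k)\<^sup>2 * (norm (p k))\<^sup>2)"
  unfolding P_def using sum_squared_le_card[of "\<lambda>k. a' k * norm (p k)" h] by (simp add: power_mult_distrib)

text \<open>A discrete Gronwall argument for \<open>y j - y 0\<close>, driven by
  \<open>B j (y 0)\<close>, the noise and the perturbation.\<close>

lemma displacement_le:
  assumes "j \<le> h"
  shows "norm (y j - y 0) \<le> growth_const K h * (a * norm (y 0) + P + a * \<rho>)"
proof -
  \<comment> \<open>\<open>T j\<close> accumulates the forcing of the first \<open>j\<close> steps.
    Its increments are nonnegative, so they may be multiplied by the growth factor in the
    induction.\<close>
  define T where "T j = 2 * a * K * norm (y 0) * real j + (\<Sum>k<j. a' k * norm (p k)) + 2 * a * \<rho> * real j" for j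
  have T0: "T j \<ge> 0" if "j \<le> h" for j
    unfolding T_def using that a01 K \<rho> by (intro add_nonneg_nonneg sum_nonneg mult_nonneg_nonneg a'_nonneg) auto
  have "norm (y j - y 0) \<le> (1 + 2 * K) ^ j * T j" using assms
  proof (induction j)
    case 0
    show ?case by (simp add: T_def)
  next
    case (Suc j)
    then have j: "j < h" and IH: "norm (y j - y 0) \<le> (1 + 2 * K) ^ j * T j" by auto
    \<comment> \<open>Linearity separates the homogeneous part \<open>B j (y j - y 0)\<close>, to
      which the induction hypothesis applies, from the forcing \<open>B j (y 0)\<close>.\<close>
    have eq: "y (Suc j) - y 0 = (y j - y 0) + a' j *\<^sub>R (B j (y j - y 0) + B j (y 0) + p j + r j)"
      using rec[OF j] lin[OF j] by (simp add: linear_diff)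
    have "norm (y (Suc j) - y 0) \<le> norm (y j - y 0)
        + a' j * (norm (B j (y j - y 0)) + norm (B j (y 0)) + norm (p j) + norm (r j))"
      unfolding eq using a'_nonneg[OF j]
      by (intro order.trans[OF norm_triangle_ineq] add_left_mono)
         (auto intro!: mult_left_mono norm_triangle_le add_mono)
    also have "\<dots> \<le> norm (y j - y 0)
        + a' j * (K * norm (y j - y 0) + K * norm (y 0) + norm (p j) + \<rho>)"
      using a'_nonneg[OF j] by (intro add_left_mono mult_left_mono add_mono B_le r_le j) auto
    also have "\<dots> = norm (y j - y 0) + a' j * (K * norm (y j - y 0)) + a' j * (K * norm (y 0))
        + a' j * norm (p j) + a' j * \<rho>"
      by (simp add: algebra_simps)
    also have "\<dots> \<le> norm (y j - y 0) + 2 * (K * norm (y j - y 0)) + 2 * a * (K * norm (y 0))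
        + a' j * norm (p j) + 2 * a * \<rho>"
      using a'_le[OF j] a01 K \<rho> by (intro add_mono order.refl mult_right_mono) auto
    also have "\<dots> = (1 + 2 * K) * norm (y j - y 0) + (T (Suc j) - T j)"
      by (simp add: T_def algebra_simps)
    also have "\<dots> \<le> (1 + 2 * K) * ((1 + 2 * K) ^ j * T j) + (1 + 2 * K) ^ Suc j * (T (Suc j) - T j)"
    proof (intro add_mono mult_left_mono IH)
      have "T (Suc j) - T j \<ge> 0" unfolding T_def
        using a01 K \<rho> a'_nonneg[OF j] by (simp add: algebra_simps)
      moreover have "1 \<le> (1 + 2 * K) ^ Suc j" using K by (intro one_le_power) simp
      ultimately show "T (Suc j) - T j \<le> (1 + 2 * K) ^ Suc j * (T (Suc j) - T j)"
        using mult_right_mono[of 1 "(1 + 2 * K) ^ Suc j"] by fastforce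
    qed (use K in simp)
    also have "\<dots> = (1 + 2 * K) ^ Suc j * T (Suc j)" by (simp add: algebra_simps)
    finally show ?case .
  qed
  also have "\<dots> \<le> (1 + 2 * K) ^ h * ((2 * K * real h + 2 * real h + 1) * (a * norm (y 0) + P + a * \<rho>))"
  proof (rule mult_mono)
    show "(1 + 2 * K) ^ j \<le> (1 + 2 * K) ^ h" using assms K by (intro power_increasing) auto
    have "(\<Sum>k<j. a' k * norm (p k)) \<le> P" unfolding P_def
      using assms a'_nonneg by (intro sum_mono2) auto
    moreover have "2 * a * K * norm (y 0) * real j \<le> 2 * a * K * norm (y 0) * real h"
      "2 * a * \<rho> * real j \<le> 2 * a * \<rho> * real h"
      using assms a01 K \<rho> by (intro mult_left_mono; auto)+
    ultimately have "T j \<le> 2 * a * K * norm (y 0) * real h + P + 2 * a * \<rho> * real h"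
      unfolding T_def by linarith
    also have "\<dots> = (2 * K * real h) * (a * norm (y 0)) + 1 * P + (2 * real h) * (a * \<rho>)" by simp
    also have "\<dots> \<le> (2 * K * real h + 2 * real h + 1) * (a * norm (y 0))
        + (2 * K * real h + 2 * real h + 1) * P + (2 * K * real h + 2 * real h + 1) * (a * \<rho>)"
      using a01 K \<rho> P_nonneg by (intro add_mono mult_right_mono) auto
    finally show "T j \<le> (2 * K * real h + 2 * real h + 1) * (a * norm (y 0) + P + a * \<rho>)"
      by (simp add: algebra_simps)
  qed (use T0[OF assms] K in auto)
  finally show ?thesis by (simp add: growth_const_def mult.assoc)
qed

text \<open>The error made by freezing the state at \<open>y 0\<close>, replacing \<open>B\<close>
  by \<open>C\<close> and \<open>a' k\<close> by \<open>a\<close>, and dropping \<open>r\<close>.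
  The noise keeps its exact step sizes: it is not small pathwise and disappears only after
  integration.\<close>

definition "rest = y h - (y 0 + a *\<^sub>R (\<Sum>k<h. C k (y 0)) + (\<Sum>k<h. a' k *\<^sub>R p k))"

abbreviation "c1 \<equiv> rest_const K h"

text \<open>Each of the four replacements contributes \<open>a\<close> times a further factor: the
  displacement bound, \<open>g\<close>, \<open>\<rho>\<close> and \<open>\<eta>\<close>
  respectively.\<close>

lemma rest_le: "norm rest \<le> a * c1 * ((a + g + \<eta>) * norm (y 0) + P + \<rho>)"
proof -
  let ?L = "growth_const K h"
  let ?u = "a * norm (y 0) + P + a * \<rho>"
  have L: "?L \<ge> 1" using K by (rule growth_const_ge_1)
  have "y j = y 0 + (\<Sum>k<j. a' k *\<^sub>R (B k (y k) + p k + r k))" if "j \<le> h" for j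
    using that by (induction j) (auto simp: rec)
  from this[OF order.refl] have "y h = y 0 + (\<Sum>k<h. a' k *\<^sub>R (B k (y k) + p k + r k))" .
  then have "rest = (\<Sum>k<h. a' k *\<^sub>R (B k (y k) + p k + r k) - a *\<^sub>R C k (y 0) - a' k *\<^sub>R p k)"
    by (simp add: rest_def sum_subtractf scaleR_sum_right)
  also have "\<dots> = (\<Sum>k<h. a' k *\<^sub>R (B k (y k - y 0) + (B k (y 0) - C k (y 0)) + r k) + (a' k - a) *\<^sub>R C k (y 0))"
    using lin by (intro sum.cong) (auto simp: linear_diff algebra_simps)
  finally have "norm rest \<le> (\<Sum>k<h. norm (a' k *\<^sub>R (B k (y k - y 0) + (B k (y 0) - C k (y 0)) + r k) + (a' k - a) *\<^sub>R C k (y 0)))"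
    by (simp add: norm_sum)
  also have "\<dots> \<le> (\<Sum>k<h. 2 * a * (K * (?L * ?u) + g * norm (y 0) + \<rho>) + \<eta> * a * (K * norm (y 0)))"
  proof (intro sum_mono)
    fix k assume "k \<in> {..<h}"
    then have k: "k < h" by simp
    have 1: "norm (B k (y k - y 0) + (B k (y 0) - C k (y 0)) + r k) \<le> K * (?L * ?u) + g * norm (y 0) + \<rho>"
      using displacement_le[of k] k K
      by (intro norm_triangle_le add_mono BC_le r_le order.trans[OF B_le mult_left_mono]) auto
    show "norm (a' k *\<^sub>R (B k (y k - y 0) + (B k (y 0) - C k (y 0)) + r k) + (a' k - a) *\<^sub>R C k (y 0))
      \<le> 2 * a * (K * (?L * ?u) + g * norm (y 0) + \<rho>) + \<eta> * a * (K * norm (y 0))"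
      using a'_nonneg[OF k] a'_le[OF k] a'_diff[OF k] C_le[OF k] 1 a01 \<eta>
      by (intro norm_triangle_le add_mono) (auto intro!: mult_mono)
  qed
  also have "\<dots> = a * (2 * real h * K * ?L * a * norm (y 0) + 2 * real h * g * norm (y 0) + real h * K * \<eta> * norm (y 0)
      + 2 * real h * K * ?L * P + 2 * real h * (K * ?L * a + 1) * \<rho>)"
    by (simp add: algebra_simps)
  also have "\<dots> \<le> a * (c1 * a * norm (y 0) + c1 * g * norm (y 0) + c1 * \<eta> * norm (y 0) + c1 * P + c1 * \<rho>)"
  proof (intro mult_left_mono add_mono mult_right_mono)
    have KL: "0 \<le> K * ?L" using K L by simp
    have hKL: "0 \<le> real h * (K * ?L)" "0 \<le> real h * K" "0 \<le> real h" using KL K by auto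
    have "real h * (K * ?L * a) \<le> real h * (K * ?L)"
      using KL a01 by (intro mult_left_mono) (auto intro: mult_left_le)
    then show "2 * real h * (K * ?L * a + 1) \<le> c1" using hKL by (simp add: rest_const_def algebra_simps)
    show "2 * real h * K * ?L \<le> c1" "2 * real h * K * ?L \<le> c1" "2 * real h \<le> c1" "real h * K \<le> c1"
      using hKL by (simp_all add: rest_const_def algebra_simps)
  qed (use a01 g \<eta> \<rho> P_nonneg in auto)
  also have "\<dots> = a * c1 * ((a + g + \<eta>) * norm (y 0) + P + \<rho>)"
    by (simp add: algebra_simps)
  finally show ?thesis .
qed

lemma c1_nonneg: "c1 \<ge> 0" "c1 \<ge> real h * K"
  using K growth_const_ge_1[OF K, of h] by (auto simp: rest_const_def)

text \<open>The square of the initial state plus increment is expanded. Mixed terms of state and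
  noise are split by the arithmetic-geometric mean inequality, so that apart from the linear noise
  term only \<open>P\<^sup>2\<close> remains, which is controlled by second moments.\<close>

lemma norm_square_expansion:
  assumes G: "\<rho> \<le> G"
  shows "(norm (y h))\<^sup>2 \<le> (norm (y 0))\<^sup>2 + 2 * a * (y 0 \<bullet> (\<Sum>k<h. C k (y 0)))
      + 2 * (\<Sum>k<h. a' k * (y 0 \<bullet> p k))
      + expansion_const K h G * (a * (a + g + \<eta> + \<rho>) * (norm (y 0))\<^sup>2 + P\<^sup>2 + a * \<rho>)"
proof -
  let ?x = "y 0" and ?n = "norm (y 0)"
  let ?S = "\<Sum>k<h. C k (y 0)" and ?N = "\<Sum>k<h. a' k *\<^sub>R p k"
  let ?v = "a *\<^sub>R ?S + ?N + rest"
  let ?E = "a * (a + g + \<eta> + \<rho>) * ?n\<^sup>2 + P\<^sup>2 + a * \<rho>"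
  define c2 where "c2 = real h * K + 1 + c1 * (3 + K)"
  note P0 = P_nonneg
  have yh: "y h = ?x + ?v" by (simp add: rest_def)
  have S: "norm ?S \<le> real h * (K * ?n)"
    using sum_norm_le[of "{..<h}" "\<lambda>k. C k ?x" "\<lambda>_. K * ?n"] C_le by simp
  have N: "norm ?N \<le> P"
    unfolding P_def using a'_nonneg by (intro sum_norm_le) auto
  have "norm ?v \<le> a * (real h * (K * ?n)) + P + a * c1 * ((a + g + \<eta>) * ?n + P + \<rho>)"
    using S a01 by (intro norm_triangle_le add_mono N rest_le) (auto intro!: mult_left_mono)
  also have "\<dots> \<le> a * (real h * (K * ?n)) + P + a * c1 * ((2 + K) * ?n + P + \<rho>)"
    using a01 g \<eta> c1_nonneg by (intro add_left_mono mult_left_mono add_right_mono mult_right_mono) auto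
  also have "\<dots> = (real h * K + c1 * (2 + K)) * (a * ?n) + (1 + a * c1) * P + c1 * (a * \<rho>)"
    by (simp add: algebra_simps)
  also have "\<dots> \<le> c2 * (a * ?n) + c2 * P + c2 * (a * \<rho>)"
  proof (intro add_mono mult_right_mono)
    have "a * c1 \<le> 1 * c1" by (intro mult_right_mono a01 c1_nonneg)
    moreover have "0 \<le> c1 * K" "0 \<le> real h * K" using c1_nonneg K by auto
    ultimately show "1 + a * c1 \<le> c2" "c1 \<le> c2" "real h * K + c1 * (2 + K) \<le> c2"
      using c1_nonneg by (simp_all add: c2_def distrib_left)
  qed (use a01 P0 \<rho> in auto)
  finally have v: "norm ?v \<le> c2 * (a * ?n + P + a * \<rho>)" by (simp only: distrib_left)
  have "(norm ?v)\<^sup>2 \<le> c2\<^sup>2 * (a * ?n + P + a * \<rho>)\<^sup>2"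
    using power_mono[OF v, of 2] by (simp only: power_mult_distrib norm_ge_zero)
  also have "\<dots> \<le> c2\<^sup>2 * (3 * ((a * ?n)\<^sup>2 + P\<^sup>2 + (a * \<rho>)\<^sup>2))"
    by (intro mult_left_mono square_sum3_le) auto
  also have "\<dots> \<le> c2\<^sup>2 * (3 * ((1 + G) * ?E))"
  proof (intro mult_left_mono)
    have G0: "G \<ge> 0" using G \<rho> by simp
    have E0: "0 \<le> a * (g + \<eta> + \<rho>) * ?n\<^sup>2" using a01 g \<eta> \<rho> by auto
    \<comment> \<open>One factor \<open>a\<close> is bounded by 1 and one factor
      \<open>\<rho>\<close> by \<open>G\<close>, leaving an error linear in
      \<open>a * \<rho>\<close>. This is what makes summability of \<open>\<alpha> t * g2 t\<close>
      sufficient later.\<close>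
    have "a * a * (\<rho> * \<rho>) \<le> 1 * a * (\<rho> * G)" using a01 \<rho> G by (intro mult_mono) auto
    then have "(a * ?n)\<^sup>2 + P\<^sup>2 + (a * \<rho>)\<^sup>2 \<le> a * a * ?n\<^sup>2 + P\<^sup>2 + G * (a * \<rho>)"
      by (simp add: power2_eq_square algebra_simps)
    also have "\<dots> \<le> ?E + G * ?E"
    proof (rule add_mono)
      have "0 \<le> a * \<rho>" using a01 \<rho> by simp
      then show "a * a * ?n\<^sup>2 + P\<^sup>2 \<le> ?E" using E0 by (simp add: algebra_simps)
      show "G * (a * \<rho>) \<le> G * ?E"
        using G0 a01 g \<eta> \<rho> by (intro mult_left_mono) auto
    qed
    finally show "(a * ?n)\<^sup>2 + P\<^sup>2 + (a * \<rho>)\<^sup>2 \<le> (1 + G) * ?E" by (simp add: distrib_right)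
  qed auto
  finally have v2: "(norm ?v)\<^sup>2 \<le> 3 * c2\<^sup>2 * (1 + G) * ?E" by (simp only: mult_ac)
  have "?x \<bullet> rest \<le> ?n * (a * c1 * ((a + g + \<eta>) * ?n + P + \<rho>))"
    by (rule order.trans[OF norm_cauchy_schwarz mult_left_mono[OF rest_le]]) simp
  also have "\<dots> = c1 * (a * (a + g + \<eta>) * ?n\<^sup>2 + a * ?n * P + a * \<rho> * ?n)"
    by (simp add: power2_eq_square algebra_simps)
  also have "\<dots> \<le> c1 * (2 * ?E)"
  proof (intro mult_left_mono c1_nonneg)
    have 1: "a * ?n * P \<le> a * a * ?n\<^sup>2 + P\<^sup>2"
    proof -
      have "2 * (a * ?n) * P \<le> (a * ?n)\<^sup>2 + P\<^sup>2" by (rule sum_squares_bound)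
      moreover have "0 \<le> a * ?n * P" using a01 P0 by simp
      ultimately show ?thesis by (simp add: power2_eq_square algebra_simps)
    qed
    \<comment> \<open>The perturbation meets the state linearly; bounding the norm by its square
      plus 1 puts it into the form of the two error terms with factor
      \<open>a * \<rho>\<close>.\<close>
    have "2 * ?n \<le> ?n\<^sup>2 + 1" using sum_squares_bound[of ?n 1] by simp
    then have "?n \<le> ?n\<^sup>2 + 1" using norm_ge_zero[of ?x] by linarith
    then have 2: "a * \<rho> * ?n \<le> a * \<rho> * (?n\<^sup>2 + 1)" using a01 \<rho> by (intro mult_left_mono) auto
    have 3: "0 \<le> a * g * ?n\<^sup>2" "0 \<le> a * \<eta> * ?n\<^sup>2" "0 \<le> a * \<rho> * ?n\<^sup>2" "0 \<le> a * \<rho>" "0 \<le> P\<^sup>2"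
      using a01 g \<eta> \<rho> by auto
    show "a * (a + g + \<eta>) * ?n\<^sup>2 + a * ?n * P + a * \<rho> * ?n \<le> 2 * ?E"
      using 1 2 3 by (simp only: distrib_left distrib_right mult_ac mult_1_right mult_1_left)
  qed
  finally have xr: "2 * (?x \<bullet> rest) \<le> 4 * c1 * ?E" by (simp only: mult.assoc mult.left_commute[of c1])
  have "(norm (y h))\<^sup>2 = ?n\<^sup>2 + 2 * (?x \<bullet> ?v) + (norm ?v)\<^sup>2"
    unfolding yh power2_norm_eq_inner by (simp add: inner_commute algebra_simps)
  also have "2 * (?x \<bullet> ?v) = 2 * a * (?x \<bullet> ?S) + 2 * (\<Sum>k<h. a' k * (?x \<bullet> p k)) + 2 * (?x \<bullet> rest)"
    by (simp add: inner_add_right inner_sum_right)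
  finally show ?thesis using v2 xr unfolding expansion_const_def c2_def by (simp only: distrib_right)
qed

text \<open>A cruder bound at every time of the block, without the drift. It carries convergence
  from the block starts to all times.\<close>

lemma norm_square_le:
  assumes G: "\<rho> \<le> G" and j: "j \<le> h"
  shows "(norm (y j))\<^sup>2 \<le> 3 * (1 + growth_const K h)\<^sup>2 * (1 + G) * ((norm (y 0))\<^sup>2 + P\<^sup>2 + a * \<rho>)"
proof -
  let ?L = "growth_const K h" and ?n = "norm (y 0)"
  have L: "?L \<ge> 1" using K by (rule growth_const_ge_1)
  have "norm (y j) \<le> ?n + norm (y j - y 0)"
    using norm_triangle_ineq[of "y 0" "y j - y 0"] by simp
  also have "\<dots> \<le> ?n + ?L * (a * ?n + P + a * \<rho>)" using displacement_le[OF j] by simp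
  also have "\<dots> \<le> (?n + P + a * \<rho>) + ?L * (?n + P + a * \<rho>)"
    using L a01 P_nonneg \<rho> by (intro add_mono mult_left_mono) (auto intro: mult_left_le_one_le)
  finally have "norm (y j) \<le> (1 + ?L) * (?n + P + a * \<rho>)" by (simp add: distrib_right)
  from power_mono[OF this, of 2]
  have "(norm (y j))\<^sup>2 \<le> (1 + ?L)\<^sup>2 * (?n + P + a * \<rho>)\<^sup>2" by (simp only: power_mult_distrib norm_ge_zero)
  also have "\<dots> \<le> (1 + ?L)\<^sup>2 * (3 * (?n\<^sup>2 + P\<^sup>2 + (a * \<rho>)\<^sup>2))"
    by (intro mult_left_mono square_sum3_le) auto
  also have "\<dots> \<le> (1 + ?L)\<^sup>2 * (3 * ((1 + G) * (?n\<^sup>2 + P\<^sup>2 + a * \<rho>)))"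
  proof (intro mult_left_mono)
    have "a * a * (\<rho> * \<rho>) \<le> 1 * a * (\<rho> * G)" using a01 \<rho> G by (intro mult_mono) auto
    moreover have "0 \<le> G * (?n\<^sup>2 + P\<^sup>2)" "0 \<le> a * \<rho>" using G \<rho> a01 by auto
    ultimately show "?n\<^sup>2 + P\<^sup>2 + (a * \<rho>)\<^sup>2 \<le> (1 + G) * (?n\<^sup>2 + P\<^sup>2 + a * \<rho>)"
      by (simp add: power2_eq_square algebra_simps)
  qed auto
  finally show ?thesis by (simp only: mult_ac)
qed

end

section \<open>Quadratic forms of symmetric matrices\<close>

lemma symmetric_matrix_inner:
  fixes A :: "real^'n^'n"
  assumes "transpose A = A"
  shows "(A *v x) \<bullet> y = x \<bullet> (A *v y)"
  using dot_lmul_matrix[of x A y] transpose_matrix_vector[of A x] assms by simp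

text \<open>\<open>lambda_max\<close> is a \<open>Max\<close>, so comparing an eigenvalue with it
  requires finiteness. Eigenvectors of distinct eigenvalues are orthogonal, hence independent, and
  so finite in number.\<close>

lemma finite_eigenvalues_symmetric:
  fixes A :: "real^'n^'n"
  assumes A: "transpose A = A"
  shows "finite {l. \<exists>x. x \<noteq> 0 \<and> A *v x = l *\<^sub>R x}" (is "finite ?S")
proof -
  have "\<forall>l\<in>?S. \<exists>x. x \<noteq> 0 \<and> A *v x = l *\<^sub>R x" by simp
  from bchoice[OF this] obtain v where "\<forall>l\<in>?S. v l \<noteq> 0 \<and> A *v v l = l *\<^sub>R v l" ..
  then have v: "\<And>l. l \<in> ?S \<Longrightarrow> v l \<noteq> 0" "\<And>l. l \<in> ?S \<Longrightarrow> A *v v l = l *\<^sub>R v l"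
    by auto
  have orth: "v l \<bullet> v k = 0" if "l \<in> ?S" "k \<in> ?S" "l \<noteq> k" for l k
  proof -
    have "l * (v l \<bullet> v k) = k * (v l \<bullet> v k)"
      using symmetric_matrix_inner[OF A, of "v l" "v k"] v(2)[OF that(1)] v(2)[OF that(2)] by simp
    then show ?thesis using that(3) by simp
  qed
  have inj: "inj_on v ?S"
  proof (rule inj_onI, rule ccontr)
    fix l k assume "l \<in> ?S" "k \<in> ?S" "v l = v k" "l \<noteq> k"
    with orth[of l k] v(1)[of k] show False by simp
  qed
  have "independent (v ` ?S)"
  proof (rule pairwise_orthogonal_independent)
    show "pairwise orthogonal (v ` ?S)"
    proof (rule pairwiseI)
      fix x y assume "x \<in> v ` ?S" "y \<in> v ` ?S" "x \<noteq> y"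
      then obtain l k where lk: "l \<in> ?S" "k \<in> ?S" "l \<noteq> k" and "x = v l" "y = v k" by blast
      then show "orthogonal x y" using orth[OF lk] by (simp add: orthogonal_def)
    qed
    show "0 \<notin> v ` ?S" using v(1) by fastforce
  qed
  then have "finite (v ` ?S)" by (rule independent_imp_finite)
  then show ?thesis using inj by (rule finite_imageD)
qed

text \<open>A maximiser of the Rayleigh quotient on the unit sphere is an eigenvector.\<close>

lemma quadratic_form_le_lambda_max:
  fixes A :: "real^'n^'n"
  assumes A: "transpose A = A"
  shows "x \<bullet> (A *v x) \<le> lambda_max A * (norm x)\<^sup>2"
proof -
  have "\<exists>z\<in>sphere 0 1. \<forall>y\<in>sphere 0 1. y \<bullet> (A *v y) \<le> z \<bullet> (A *v z)"
  proof (rule continuous_attains_sup)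
    show "continuous_on (sphere 0 1) (\<lambda>y. y \<bullet> (A *v y))"
      by (intro continuous_intros)
  qed auto
  then obtain z :: "real^'n" where z: "norm z = 1"
    and zmax: "\<And>y. norm y = 1 \<Longrightarrow> y \<bullet> (A *v y) \<le> z \<bullet> (A *v z)"
    by auto
  define \<mu> where "\<mu> = z \<bullet> (A *v z)"
  have le: "y \<bullet> (A *v y) \<le> \<mu> * (y \<bullet> y)" for y
  proof (cases "y = 0")
    case False
    define w where "w = (1 / norm y) *\<^sub>R y"
    have y: "y = norm y *\<^sub>R w" using False by (simp add: w_def)
    have "norm w = 1" using False by (simp add: w_def)
    from zmax[OF this] have "w \<bullet> (A *v w) \<le> \<mu>" by (simp add: \<mu>_def)
    then have "(norm y)\<^sup>2 * (w \<bullet> (A *v w)) \<le> (norm y)\<^sup>2 * \<mu>" by (intro mult_left_mono) auto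
    moreover have "y \<bullet> (A *v y) = (norm y)\<^sup>2 * (w \<bullet> (A *v w))"
      by (subst (1 2) y) (simp add: matrix_vector_mult_scaleR power2_eq_square)
    ultimately show ?thesis by (simp add: power2_norm_eq_inner mult.commute)
  qed simp
  \<comment> \<open>\<open>b\<close> is the residual of the eigenvector equation at the maximiser
    \<open>z\<close>. Maximality tested at \<open>z\<close> plus a multiple \<open>t\<close> of
    \<open>b\<close> gives a quadratic in \<open>t\<close> without constant term that is never
    negative, which forces its linear coefficient, twice the squared norm of \<open>b\<close>, to
    vanish.\<close>
  define b where "b = \<mu> *\<^sub>R z - A *v z"
  define q where "q = b \<bullet> (\<mu> *\<^sub>R b - A *v b)"
  have q: "q \<ge> 0" using le[of b] by (simp add: q_def inner_diff_right)
  have zz: "z \<bullet> z = 1" using z by (simp add: norm_eq_1)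
  have bz: "b \<bullet> b = \<mu> * (b \<bullet> z) - b \<bullet> (A *v z)" by (simp add: b_def inner_diff_right)
  have zb: "z \<bullet> (A *v b) = b \<bullet> (A *v z)"
    using symmetric_matrix_inner[OF A, of z b] by (simp add: inner_commute)
  have pert: "0 \<le> 2 * t * (b \<bullet> b) + t\<^sup>2 * q" for t
  proof -
    have e1: "(z + t *\<^sub>R b) \<bullet> (A *v (z + t *\<^sub>R b)) = \<mu> + 2 * t * (b \<bullet> (A *v z)) + t\<^sup>2 * (b \<bullet> (A *v b))"
      by (simp add: matrix_vector_right_distrib matrix_vector_mult_scaleR inner_add_left inner_add_right
          zb \<mu>_def power2_eq_square algebra_simps)
    have e2: "\<mu> * ((z + t *\<^sub>R b) \<bullet> (z + t *\<^sub>R b)) = \<mu> + 2 * t * (\<mu> * (b \<bullet> z)) + t\<^sup>2 * (\<mu> * (b \<bullet> b))"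
      by (simp add: inner_add_left inner_add_right zz power2_eq_square inner_commute algebra_simps)
    have e3: "2 * t * (b \<bullet> b) + t\<^sup>2 * q
        = 2 * t * (\<mu> * (b \<bullet> z) - b \<bullet> (A *v z)) + t\<^sup>2 * (\<mu> * (b \<bullet> b) - b \<bullet> (A *v b))"
      by (simp only: q_def bz[symmetric] inner_diff_right inner_scaleR_right)
    show ?thesis
      using le[of "z + t *\<^sub>R b"] unfolding e1 e2 e3 by (simp only: right_diff_distrib)
  qed
  define s where "s = b \<bullet> b"
  have "s = 0"
  proof -
    \<comment> \<open>With \<open>t = - r\<close> the quadratic becomes
      \<open>- (r\<^sup>2 * (q + 2))\<close>; the denominator \<open>q + 1\<close> is positive even
      when \<open>q = 0\<close>.\<close>
    define r where "r = s / (q + 1)"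
    have s: "s = r * (q + 1)" using q by (simp add: r_def)
    have "0 \<le> 2 * (- r) * s + (- r)\<^sup>2 * q" using pert[of "- r"] unfolding s_def .
    also have "\<dots> = - (r\<^sup>2 * (q + 2))" unfolding s by (simp add: power2_eq_square algebra_simps)
    finally have "r\<^sup>2 * (q + 2) \<le> 0" by simp
    then have "r = 0" using q by (auto simp: mult_le_0_iff)
    then show ?thesis by (simp add: s)
  qed
  then have "A *v z = \<mu> *\<^sub>R z" by (simp add: s_def b_def)
  moreover have "z \<noteq> 0" using z by auto
  ultimately have "\<mu> \<le> lambda_max A"
    unfolding lambda_max_def by (intro Max_ge finite_eigenvalues_symmetric A) auto
  then have "\<mu> * (norm x)\<^sup>2 \<le> lambda_max A * (norm x)\<^sup>2" by (intro mult_right_mono) auto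
  with le[of x] show ?thesis by (simp add: power2_norm_eq_inner)
qed

section \<open>Conditional expectations of linear and quadratic forms\<close>

lemma norm_matrix_vector_le_mnorm: "norm (A *v x) \<le> mnorm A * norm x"
  unfolding mnorm_def by (rule onorm) (rule matrix_vector_mul_bounded_linear)

lemma mnorm_nonneg: "0 \<le> mnorm A"
  unfolding mnorm_def by (rule onorm_pos_le) (rule matrix_vector_mul_bounded_linear)

lemma borel_measurable_vec_nth [measurable (raw)]:
  fixes f :: "'a \<Rightarrow> 'b::topological_space^'n"
  assumes "f \<in> borel_measurable M"
  shows "(\<lambda>x. f x $ i) \<in> borel_measurable M"
  by (rule measurable_compose[OF assms borel_measurable_continuous_onI]) (intro continuous_intros)

lemma borel_measurable_vecI:
  fixes f :: "'a \<Rightarrow> real^'n"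
  assumes "\<And>i. (\<lambda>x. f x $ i) \<in> borel_measurable M"
  shows "f \<in> borel_measurable M"
proof (subst borel_measurable_euclidean_space, rule ballI)
  fix b :: "real^'n" assume "b \<in> Basis"
  then obtain i where b: "b = axis i 1" by (auto simp: Basis_vec_def)
  show "(\<lambda>x. f x \<bullet> b) \<in> borel_measurable M"
    unfolding b inner_axis by (simp add: assms)
qed

lemma borel_measurable_matrix_vector_mult [measurable (raw)]:
  fixes A :: "'a \<Rightarrow> real^'n^'m"
  assumes [measurable]: "A \<in> borel_measurable M" "x \<in> borel_measurable M"
  shows "(\<lambda>\<omega>. A \<omega> *v x \<omega>) \<in> borel_measurable M"
  by (rule borel_measurable_vecI) (simp add: matrix_vector_mult_def)

lemma integrable_mult_square:
  fixes f g :: "'a \<Rightarrow> real"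
  assumes [measurable]: "f \<in> borel_measurable M" "g \<in> borel_measurable M"
    and "integrable M (\<lambda>x. (f x)\<^sup>2)" "integrable M (\<lambda>x. (g x)\<^sup>2)"
  shows "integrable M (\<lambda>x. f x * g x)"
proof (rule Bochner_Integration.integrable_bound)
  show "integrable M (\<lambda>x. (f x)\<^sup>2 + (g x)\<^sup>2)" by (intro Bochner_Integration.integrable_add assms)
  have "\<bar>f x * g x\<bar> \<le> (f x)\<^sup>2 + (g x)\<^sup>2" for x
  proof -
    have "2 * (\<bar>f x\<bar> * \<bar>g x\<bar>) \<le> (f x)\<^sup>2 + (g x)\<^sup>2"
      using sum_squares_bound[of "\<bar>f x\<bar>" "\<bar>g x\<bar>"] by simp
    moreover have "0 \<le> \<bar>f x\<bar> * \<bar>g x\<bar>" by simp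
    ultimately show ?thesis unfolding abs_mult by linarith
  qed
  then show "AE x in M. norm (f x * g x) \<le> norm ((f x)\<^sup>2 + (g x)\<^sup>2)" by (intro AE_I2) simp
qed measurable

lemma integrable_component_square:
  fixes f :: "'a \<Rightarrow> real^'n"
  assumes [measurable]: "f \<in> borel_measurable M" and "integrable M (\<lambda>x. (norm (f x))\<^sup>2)"
  shows "integrable M (\<lambda>x. (f x $ i)\<^sup>2)"
proof (rule Bochner_Integration.integrable_bound[OF assms(2)])
  have "(f x $ i)\<^sup>2 \<le> (norm (f x))\<^sup>2" for x
    using component_le_norm_cart[of "f x" i] by (simp flip: abs_le_square_iff)
  then show "AE x in M. norm ((f x $ i)\<^sup>2) \<le> norm ((norm (f x))\<^sup>2)" by (intro AE_I2) simp
qed measurable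

context finite_measure_subalgebra
begin

text \<open>The components of \<open>z\<close> are \<open>F\<close>-measurable, so under the
  integral each component of \<open>E\<close> can be replaced by its conditional expectation. This
  removes the martingale terms.\<close>

lemma integral_inner_eq_0_of_cond_exp:
  fixes z E :: "'a \<Rightarrow> real^'n"
  assumes z[measurable]: "z \<in> borel_measurable F" and z2: "integrable M (\<lambda>x. (norm (z x))\<^sup>2)"
    and E[measurable]: "E \<in> borel_measurable M" and E2: "integrable M (\<lambda>x. (norm (E x))\<^sup>2)"
    and ce: "AE \<omega> in M. cond_exp_vec M F E \<omega> = 0"
  shows "integrable M (\<lambda>\<omega>. z \<omega> \<bullet> E \<omega>)" "(\<integral>\<omega>. z \<omega> \<bullet> E \<omega> \<partial>M) = 0"
proof -
  have zM[measurable]: "z \<in> borel_measurable M" by (rule measurable_from_subalg[OF subalg z])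
  have int: "integrable M (\<lambda>\<omega>. z \<omega> $ i * E \<omega> $ i)" for i
    by (intro integrable_mult_square integrable_component_square z2 E2) measurable
  then show "integrable M (\<lambda>\<omega>. z \<omega> \<bullet> E \<omega>)" by (simp add: inner_vec_def)
  have "(\<integral>\<omega>. z \<omega> $ i * E \<omega> $ i \<partial>M) = 0" for i
  proof -
    have "(\<integral>\<omega>. z \<omega> $ i * E \<omega> $ i \<partial>M) = (\<integral>\<omega>. z \<omega> $ i * real_cond_exp M F (\<lambda>\<omega>. E \<omega> $ i) \<omega> \<partial>M)"
      by (intro real_cond_exp_intg(2)[symmetric] int) measurable
    also have "\<dots> = (\<integral>\<omega>. 0 \<partial>M)"
    proof (rule integral_cong_AE)
      show "AE \<omega> in M. z \<omega> $ i * real_cond_exp M F (\<lambda>\<omega>. E \<omega> $ i) \<omega> = 0"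
        using ce by eventually_elim (simp add: cond_exp_vec_def vec_eq_iff)
    qed measurable
    finally show ?thesis by simp
  qed
  then show "(\<integral>\<omega>. z \<omega> \<bullet> E \<omega> \<partial>M) = 0" by (simp add: inner_vec_def int)
qed

text \<open>Twice the quadratic form of \<open>Q\<close> is that of \<open>Q\<close> plus its
  transpose. The products of components of \<open>z\<close> are \<open>F\<close>-measurable, so the
  entries may be replaced by conditional expectations under the integral, after which the eigenvalue
  bound applies pointwise.\<close>

lemma integral_quadratic_form_le:
  fixes z :: "'a \<Rightarrow> real^'n" and Q :: "'i \<Rightarrow> 'a \<Rightarrow> real^'n^'n"
  assumes z[measurable]: "z \<in> borel_measurable F" and z2: "integrable M (\<lambda>x. (norm (z x))\<^sup>2)"
    and Q[measurable]: "\<And>t. Q t \<in> borel_measurable M"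
    and bdd: "\<And>t. AE \<omega> in M. mnorm (Q t \<omega>) \<le> K"
    and neg: "AE \<omega> in M. lambda_max (\<Sum>t\<in>T. cond_exp_mat M F (\<lambda>x. Q t x + transpose (Q t x)) \<omega>) \<le> - lam"
  shows "integrable M (\<lambda>\<omega>. z \<omega> \<bullet> (\<Sum>t\<in>T. Q t \<omega> *v z \<omega>))"
    and "2 * (\<integral>\<omega>. z \<omega> \<bullet> (\<Sum>t\<in>T. Q t \<omega> *v z \<omega>) \<partial>M) \<le> - lam * (\<integral>\<omega>. (norm (z \<omega>))\<^sup>2 \<partial>M)"
proof -
  have zM[measurable]: "z \<in> borel_measurable M" by (rule measurable_from_subalg[OF subalg z])
  define W where "W t x = Q t x + transpose (Q t x)" for t x
  have W_nth: "W t x $ i $ j = Q t x $ i $ j + Q t x $ j $ i" for t x i j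
    by (simp add: W_def transpose_def)
  define S where "S \<omega> = (\<Sum>t\<in>T. cond_exp_mat M F (W t) \<omega>)" for \<omega>
  have S_nth: "S \<omega> $ i $ j = (\<Sum>t\<in>T. real_cond_exp M F (\<lambda>x. W t x $ i $ j) \<omega>)" for \<omega> i j
    by (simp add: S_def cond_exp_mat_def)
  \<comment> \<open>Symmetry holds at every point and not just almost everywhere: the entries
    \<open>(i, j)\<close> and \<open>(j, i)\<close> of \<open>W t\<close> are the same function, so
    they have the same version of the conditional expectation.\<close>
  have symm: "transpose (S \<omega>) = S \<omega>" for \<omega>
    by (simp add: vec_eq_iff transpose_def S_nth W_nth add.commute)
  have intQ: "integrable M (\<lambda>\<omega>. z \<omega> $ i * z \<omega> $ j * Q t \<omega> $ k $ l)" for i j k l t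
  proof (rule Bochner_Integration.integrable_bound)
    show "integrable M (\<lambda>\<omega>. K * (z \<omega> $ i * z \<omega> $ j))"
      by (intro integrable_mult_right integrable_mult_square integrable_component_square z2) measurable
    show "AE \<omega> in M. norm (z \<omega> $ i * z \<omega> $ j * Q t \<omega> $ k $ l) \<le> norm (K * (z \<omega> $ i * z \<omega> $ j))"
      using bdd[of t]
    proof eventually_elim
      case (elim \<omega>)
      have "\<bar>Q t \<omega> $ k $ l\<bar> \<le> \<bar>K\<bar>"
        using matrix_component_le_onorm[of "Q t \<omega>" k l] elim by (simp add: mnorm_def)
      from mult_left_mono[OF this, of "\<bar>z \<omega> $ i * z \<omega> $ j\<bar>"] show ?case
        by (simp add: abs_mult mult_ac)
    qed
  qed measurable
  have intW: "integrable M (\<lambda>\<omega>. z \<omega> $ i * z \<omega> $ j * W t \<omega> $ k $ l)" for i j k l t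
    by (simp add: W_nth distrib_left intQ)
  have [measurable]: "(\<lambda>\<omega>. W t \<omega> $ i $ j) \<in> borel_measurable M" for t i j
    unfolding W_nth by measurable
  have ce: "integrable M (\<lambda>\<omega>. z \<omega> $ i * z \<omega> $ j * real_cond_exp M F (\<lambda>x. W t x $ i $ j) \<omega>)"
    "(\<integral>\<omega>. z \<omega> $ i * z \<omega> $ j * real_cond_exp M F (\<lambda>x. W t x $ i $ j) \<omega> \<partial>M)
      = (\<integral>\<omega>. z \<omega> $ i * z \<omega> $ j * W t \<omega> $ i $ j \<partial>M)" for i j t
    by (intro real_cond_exp_intg intW; measurable)+
  have zS: "z \<omega> \<bullet> (S \<omega> *v z \<omega>)
      = (\<Sum>i\<in>UNIV. \<Sum>j\<in>UNIV. \<Sum>t\<in>T. z \<omega> $ i * z \<omega> $ j * real_cond_exp M F (\<lambda>x. W t x $ i $ j) \<omega>)" for \<omega>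
    by (simp add: inner_vec_def matrix_vector_mult_def S_nth sum_distrib_left sum_distrib_right mult_ac)
  have zQ: "z \<omega> \<bullet> (\<Sum>t\<in>T. Q t \<omega> *v z \<omega>)
      = (\<Sum>i\<in>UNIV. \<Sum>j\<in>UNIV. \<Sum>t\<in>T. z \<omega> $ i * z \<omega> $ j * Q t \<omega> $ i $ j)" for \<omega>
    by (simp add: inner_vec_def matrix_vector_mult_def sum_distrib_left sum_distrib_right mult_ac)
       (intro sum.cong refl sum.swap)
  show int: "integrable M (\<lambda>\<omega>. z \<omega> \<bullet> (\<Sum>t\<in>T. Q t \<omega> *v z \<omega>))"
    unfolding zQ by (intro Bochner_Integration.integrable_sum intQ)
  have intS: "integrable M (\<lambda>\<omega>. z \<omega> \<bullet> (S \<omega> *v z \<omega>))"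
    unfolding zS by (intro Bochner_Integration.integrable_sum ce)
  have zW: "(\<Sum>i\<in>UNIV. \<Sum>j\<in>UNIV. \<Sum>t\<in>T. z \<omega> $ i * z \<omega> $ j * W t \<omega> $ i $ j)
      = 2 * (z \<omega> \<bullet> (\<Sum>t\<in>T. Q t \<omega> *v z \<omega>))" for \<omega>
  proof -
    have "(\<Sum>i\<in>UNIV. \<Sum>j\<in>UNIV. \<Sum>t\<in>T. z \<omega> $ i * z \<omega> $ j * Q t \<omega> $ j $ i)
      = (\<Sum>i\<in>UNIV. \<Sum>j\<in>UNIV. \<Sum>t\<in>T. z \<omega> $ i * z \<omega> $ j * Q t \<omega> $ i $ j)"
      by (subst sum.swap) (simp add: mult_ac)
    then show ?thesis unfolding zQ W_nth by (simp add: distrib_left sum.distrib)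
  qed
  have "(\<integral>\<omega>. z \<omega> \<bullet> (S \<omega> *v z \<omega>) \<partial>M)
      = (\<Sum>i\<in>UNIV. \<Sum>j\<in>UNIV. \<Sum>t\<in>T. \<integral>\<omega>. z \<omega> $ i * z \<omega> $ j * W t \<omega> $ i $ j \<partial>M)"
    unfolding zS by (simp add: ce Bochner_Integration.integral_sum Bochner_Integration.integrable_sum)
  also have "\<dots> = (\<integral>\<omega>. (\<Sum>i\<in>UNIV. \<Sum>j\<in>UNIV. \<Sum>t\<in>T. z \<omega> $ i * z \<omega> $ j * W t \<omega> $ i $ j) \<partial>M)"
    by (simp add: intW Bochner_Integration.integral_sum Bochner_Integration.integrable_sum)
  also have "\<dots> = 2 * (\<integral>\<omega>. z \<omega> \<bullet> (\<Sum>t\<in>T. Q t \<omega> *v z \<omega>) \<partial>M)"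
    unfolding zW by simp
  finally have "2 * (\<integral>\<omega>. z \<omega> \<bullet> (\<Sum>t\<in>T. Q t \<omega> *v z \<omega>) \<partial>M) = (\<integral>\<omega>. z \<omega> \<bullet> (S \<omega> *v z \<omega>) \<partial>M)" ..
  also have "\<dots> \<le> (\<integral>\<omega>. - lam * (norm (z \<omega>))\<^sup>2 \<partial>M)"
  proof (rule integral_mono_AE[OF intS])
    show "integrable M (\<lambda>\<omega>. - lam * (norm (z \<omega>))\<^sup>2)" by (intro integrable_mult_right z2)
    show "AE \<omega> in M. z \<omega> \<bullet> (S \<omega> *v z \<omega>) \<le> - lam * (norm (z \<omega>))\<^sup>2"
      using neg
    proof eventually_elim
      case (elim \<omega>)
      then have "lambda_max (S \<omega>) \<le> - lam" by (simp add: S_def W_def[abs_def])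
      then have "lambda_max (S \<omega>) * (norm (z \<omega>))\<^sup>2 \<le> - lam * (norm (z \<omega>))\<^sup>2"
        by (intro mult_right_mono) auto
      with quadratic_form_le_lambda_max[OF symm, of "z \<omega>" \<omega>] show ?case by simp
    qed
  qed
  finally show "2 * (\<integral>\<omega>. z \<omega> \<bullet> (\<Sum>t\<in>T. Q t \<omega> *v z \<omega>) \<partial>M) \<le> - lam * (\<integral>\<omega>. (norm (z \<omega>))\<^sup>2 \<partial>M)"
    by simp
qed

end

section \<open>Nonnegative almost supermartingales\<close>

context prob_space
begin

text \<open>Optional stopping written without a stopping time: \<open>c\<close> times the
  probability of having reached level \<open>c\<close>, plus the integral of \<open>V\<close> over
  the surviving paths, grows by at most \<open>\<gamma>\<close> in each step. The hypothesis
  \<open>step\<close> is therefore stated only for the survival events.\<close>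

lemma almost_supermartingale_maximal:
  fixes V :: "nat \<Rightarrow> 'a \<Rightarrow> real"
  assumes V[measurable]: "\<And>m. V m \<in> borel_measurable M" and V0: "\<And>m \<omega>. V m \<omega> \<ge> 0"
    and int: "\<And>m. integrable M (V m)"
    and step: "\<And>k. (\<integral>\<omega>. indicator {\<omega>\<in>space M. \<forall>j\<in>{n..n+k}. V j \<omega> < c} \<omega> * V (Suc (n + k)) \<omega> \<partial>M)
      \<le> (\<integral>\<omega>. indicator {\<omega>\<in>space M. \<forall>j\<in>{n..n+k}. V j \<omega> < c} \<omega> * V (n + k) \<omega> \<partial>M) + \<gamma> (n + k)"
  shows "c * prob {\<omega>\<in>space M. \<exists>j\<in>{n..n+k}. V j \<omega> \<ge> c} \<le> (\<integral>\<omega>. V n \<omega> \<partial>M) + (\<Sum>j<k. \<gamma> (n + j))"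
proof -
  define B where "B k = {\<omega>\<in>space M. \<exists>j\<in>{n..n+k}. V j \<omega> \<ge> c}" for k
  define S where "S k = {\<omega>\<in>space M. \<forall>j\<in>{n..n+k}. V j \<omega> < c}" for k
  have [measurable]: "B k \<in> sets M" "S k \<in> sets M" for k unfolding B_def S_def by measurable
  have intS: "integrable M (\<lambda>\<omega>. indicator (S k) \<omega> * V m \<omega>)" for k m
    using integrable_mult_indicator[of "S k" M "V m"] int by simp
  have intB: "integrable M (\<lambda>\<omega>. c * indicator (B k) \<omega>)" for k
    by (intro integrable_mult_right) (simp add: integrable_indicator_iff emeasure_eq_measure)
  have intBS: "(\<integral>\<omega>. c * indicator (B k) \<omega> + indicator (S l) \<omega> * V m \<omega> \<partial>M)
      = c * prob (B k) + (\<integral>\<omega>. indicator (S l) \<omega> * V m \<omega> \<partial>M)" for k l m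
    using intB intS by (simp add: Bochner_Integration.integral_add)
  have "c * prob (B k) + (\<integral>\<omega>. indicator (S k) \<omega> * V (n + k) \<omega> \<partial>M) \<le> (\<integral>\<omega>. V n \<omega> \<partial>M) + (\<Sum>j<k. \<gamma> (n + j))"
  proof (induction k)
    case 0
    have "(\<integral>\<omega>. c * indicator (B 0) \<omega> + indicator (S 0) \<omega> * V n \<omega> \<partial>M) \<le> (\<integral>\<omega>. V n \<omega> \<partial>M)"
      by (intro integral_mono Bochner_Integration.integrable_add intB intS int)
         (auto simp: B_def S_def indicator_def)
    then show ?case by (simp add: intBS)
  next
    case (Suc k)
    \<comment> \<open>A path that first reaches \<open>c\<close> at time \<open>n + Suc k\<close>
      moves from the second term, where its value is at least \<open>c\<close>, to the first, where
      it counts exactly \<open>c\<close>.\<close>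
    have "(\<integral>\<omega>. c * indicator (B (Suc k)) \<omega> + indicator (S (Suc k)) \<omega> * V (n + Suc k) \<omega> \<partial>M)
      \<le> (\<integral>\<omega>. c * indicator (B k) \<omega> + indicator (S k) \<omega> * V (n + Suc k) \<omega> \<partial>M)"
    proof (intro integral_mono Bochner_Integration.integrable_add intB intS)
      fix \<omega> assume "\<omega> \<in> space M"
      show "c * indicator (B (Suc k)) \<omega> + indicator (S (Suc k)) \<omega> * V (n + Suc k) \<omega>
        \<le> c * indicator (B k) \<omega> + indicator (S k) \<omega> * V (n + Suc k) \<omega>"
        using \<open>\<omega> \<in> space M\<close>
        by (auto simp: B_def S_def indicator_def atLeastAtMostSuc_conv not_le not_less)
    qed
    then have "c * prob (B (Suc k)) + (\<integral>\<omega>. indicator (S (Suc k)) \<omega> * V (n + Suc k) \<omega> \<partial>M)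
      \<le> c * prob (B k) + (\<integral>\<omega>. indicator (S k) \<omega> * V (n + Suc k) \<omega> \<partial>M)"
      by (simp only: intBS)
    also have "\<dots> \<le> c * prob (B k) + ((\<integral>\<omega>. indicator (S k) \<omega> * V (n + k) \<omega> \<partial>M) + \<gamma> (n + k))"
      using step[of k] by (simp add: S_def)
    also have "\<dots> \<le> (\<integral>\<omega>. V n \<omega> \<partial>M) + (\<Sum>j<Suc k. \<gamma> (n + j))"
      using Suc.IH by simp
    finally show ?case .
  qed
  moreover have "0 \<le> (\<integral>\<omega>. indicator (S k) \<omega> * V (n + k) \<omega> \<partial>M)"
    by (intro integral_nonneg_AE AE_I2) (simp add: V0)
  ultimately show ?thesis by (simp add: B_def)
qed

text \<open>The maximal inequality started at \<open>n\<close> is bounded by the mean of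
  \<open>V n\<close> plus a tail of \<open>\<gamma>\<close>. Both vanish as \<open>n\<close> grows,
  so exceeding a fixed level infinitely often has probability 0.\<close>

lemma almost_supermartingale_AE_tendsto_0:
  fixes V :: "nat \<Rightarrow> 'a \<Rightarrow> real"
  assumes sub: "\<And>m. subalgebra M (G m)" and mono: "\<And>m. sets (G m) \<subseteq> sets (G (Suc m))"
    and VG: "\<And>m. V m \<in> borel_measurable (G m)" and V0: "\<And>m \<omega>. V m \<omega> \<ge> 0"
    and int: "\<And>m. integrable M (V m)"
    and \<gamma>: "summable \<gamma>" "\<And>m. \<gamma> m \<ge> 0"
    and step: "\<And>m A. m \<ge> n0 \<Longrightarrow> A \<in> sets (G m) \<Longrightarrow>
      (\<integral>\<omega>. indicator A \<omega> * V (Suc m) \<omega> \<partial>M) \<le> (\<integral>\<omega>. indicator A \<omega> * V m \<omega> \<partial>M) + \<gamma> m"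
    and lim: "(\<lambda>m. \<integral>\<omega>. V m \<omega> \<partial>M) \<longlonglongrightarrow> 0"
  shows "AE \<omega> in M. (\<lambda>m. V m \<omega>) \<longlonglongrightarrow> 0"
proof -
  have V[measurable]: "V m \<in> borel_measurable M" for m by (rule measurable_from_subalg[OF sub VG])
  have mono_le: "sets (G m) \<subseteq> sets (G k)" if "m \<le> k" for m k
    using that by (induction rule: dec_induct) (use mono in auto)
  have null: "AE \<omega> in M. \<not> (\<forall>n. \<exists>j\<ge>n. V j \<omega> \<ge> c)" if c: "c > 0" for c
  proof -
    define Bad where "Bad = {\<omega>\<in>space M. \<forall>n. \<exists>j\<ge>n. V j \<omega> \<ge> c}"
    have [measurable]: "Bad \<in> sets M" unfolding Bad_def by measurable
    have bound: "c * prob Bad \<le> (\<integral>\<omega>. V n \<omega> \<partial>M) + (\<Sum>j. \<gamma> (j + n))" if n: "n \<ge> n0" for n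
    proof -
      define B where "B k = {\<omega>\<in>space M. \<exists>j\<in>{n..n+k}. V j \<omega> \<ge> c}" for k
      have [measurable]: "B k \<in> sets M" for k unfolding B_def by measurable
      have Bk: "c * prob (B k) \<le> (\<integral>\<omega>. V n \<omega> \<partial>M) + (\<Sum>j. \<gamma> (j + n))" for k
      proof -
        have "c * prob (B k) \<le> (\<integral>\<omega>. V n \<omega> \<partial>M) + (\<Sum>j<k. \<gamma> (n + j))"
          unfolding B_def
        proof (rule almost_supermartingale_maximal[OF V V0 int])
          fix k
          \<comment> \<open>The survival event belongs to \<open>G (n + k)\<close>: each
            \<open>V j\<close> is \<open>G j\<close>-measurable and the sigma-algebras
            increase.\<close>
          have "{\<omega>\<in>space M. \<forall>j\<in>{n..n+k}. V j \<omega> < c} \<in> sets (G (n + k))"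
          proof -
            have "{\<omega>\<in>space (G (n + k)). V j \<omega> < c} \<in> sets (G (n + k))" if "j \<le> n + k" for j
              using VG[of j] mono_le[OF that] sub[of j] sub[of "n + k"]
              by (intro borel_measurable_less) (auto simp: subalgebra_def measurable_def)
            then have "{\<omega>\<in>space (G (n + k)). \<forall>j\<in>{n..n+k}. V j \<omega> < c} \<in> sets (G (n + k))"
              by (intro sets.sets_Collect_finite_All') auto
            then show ?thesis using sub[of "n + k"] by (simp add: subalgebra_def)
          qed
          then show "(\<integral>\<omega>. indicator {\<omega>\<in>space M. \<forall>j\<in>{n..n+k}. V j \<omega> < c} \<omega> * V (Suc (n + k)) \<omega> \<partial>M)
            \<le> (\<integral>\<omega>. indicator {\<omega>\<in>space M. \<forall>j\<in>{n..n+k}. V j \<omega> < c} \<omega> * V (n + k) \<omega> \<partial>M) + \<gamma> (n + k)"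
            using n by (intro step) auto
        qed
        also have "(\<Sum>j<k. \<gamma> (n + j)) \<le> (\<Sum>j. \<gamma> (j + n))"
          unfolding add.commute[of n]
          by (intro sum_le_suminf summable_ignore_initial_segment \<gamma>) auto
        finally show ?thesis by simp
      qed
      \<comment> \<open>The bound is uniform in the horizon \<open>k\<close>, so continuity from
        below extends it to crossings at any later time.\<close>
      have "(\<lambda>k. prob (B k)) \<longlonglongrightarrow> prob (\<Union>k. B k)"
        by (rule finite_Lim_measure_incseq) (auto simp: incseq_def B_def)
      then have "(\<lambda>k. c * prob (B k)) \<longlonglongrightarrow> c * prob (\<Union>k. B k)" by (intro tendsto_intros)
      then have "c * prob (\<Union>k. B k) \<le> (\<integral>\<omega>. V n \<omega> \<partial>M) + (\<Sum>j. \<gamma> (j + n))"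
        by (rule LIMSEQ_le_const2) (use Bk in auto)
      moreover have "prob Bad \<le> prob (\<Union>k. B k)"
      proof (rule finite_measure_mono)
        show "Bad \<subseteq> (\<Union>k. B k)"
        proof
          fix \<omega> assume "\<omega> \<in> Bad"
          then obtain j where "j \<ge> n" "V j \<omega> \<ge> c" "\<omega> \<in> space M" by (auto simp: Bad_def)
          then have "\<omega> \<in> B (j - n)" by (auto simp: B_def)
          then show "\<omega> \<in> (\<Union>k. B k)" by blast
        qed
      qed measurable
      ultimately show ?thesis using c mult_left_mono[of "prob Bad" "prob (\<Union>k. B k)" c] by linarith
    qed
    have "(\<lambda>n. suminf \<gamma> - sum \<gamma> {..<n}) \<longlonglongrightarrow> suminf \<gamma> - suminf \<gamma>"
      by (intro tendsto_intros summable_LIMSEQ \<gamma>)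
    then have "(\<lambda>n. \<Sum>j. \<gamma> (j + n)) \<longlonglongrightarrow> 0"
      by (simp add: suminf_minus_initial_segment[OF \<gamma>(1)])
    from tendsto_add[OF lim this]
    have "(\<lambda>n. (\<integral>\<omega>. V n \<omega> \<partial>M) + (\<Sum>j. \<gamma> (j + n))) \<longlonglongrightarrow> 0" by simp
    then have "c * prob Bad \<le> 0"
      by (rule LIMSEQ_le_const) (use bound in blast)
    then have "prob Bad = 0" using c measure_nonneg[of M Bad] by (simp add: mult_le_0_iff)
    then show ?thesis
      by (intro AE_I[of _ _ Bad]) (auto simp: Bad_def emeasure_eq_measure)
  qed
  \<comment> \<open>Countably many levels decreasing to 0 suffice, so the exceptional sets still
    form a null set.\<close>
  have "AE \<omega> in M. \<forall>i::nat. \<not> (\<forall>n. \<exists>j\<ge>n. V j \<omega> \<ge> 1 / real (Suc i))"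
    unfolding AE_all_countable by (intro allI null) simp
  then show ?thesis
  proof eventually_elim
    case (elim \<omega>)
    show ?case
    proof (rule LIMSEQ_I)
      fix r :: real assume "r > 0"
      then obtain i where i: "1 / real (Suc i) < r" using nat_approx_posE by blast
      from spec[OF elim, of i] obtain n where n: "\<And>j. j \<ge> n \<Longrightarrow> V j \<omega> < 1 / real (Suc i)"
        by (meson not_le)
      have "\<forall>j\<ge>n. norm (V j \<omega> - 0) < r"
        using less_trans[OF n i] V0 by simp
      then show "\<exists>n. \<forall>j\<ge>n. norm (V j \<omega> - 0) < r" by blast
    qed
  qed
qed

end

section \<open>The stochastic recursion\<close>

lemma tendsto_block_index:
  fixes f :: "nat \<Rightarrow> 'b::topological_space"
  assumes "f \<longlonglongrightarrow> l" and "h > 0"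
  shows "(\<lambda>m. f (m * h + k)) \<longlonglongrightarrow> l"
proof -
  have "strict_mono (\<lambda>m::nat. m * h + k)" using assms(2) by (intro strict_monoI) simp
  from LIMSEQ_subseq_LIMSEQ[OF assms(1) this] show ?thesis by (simp add: o_def)
qed

lemma tendsto_block_quotient:
  fixes f :: "nat \<Rightarrow> 'b::topological_space"
  assumes "f \<longlonglongrightarrow> l" and "h > 0"
  shows "(\<lambda>t. f (t div h)) \<longlonglongrightarrow> l"
proof (rule filterlim_compose[OF assms(1)])
  show "filterlim (\<lambda>t. t div h) sequentially sequentially"
    unfolding filterlim_at_top
  proof
    fix Z
    have "\<forall>t\<ge>Z * h. Z \<le> t div h" using assms(2) by (simp add: less_eq_div_iff_mult_less_eq)
    then show "\<forall>\<^sub>F t in sequentially. Z \<le> t div h" unfolding eventually_sequentially by blast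
  qed
qed

section \<open>The filtration: inclusions and measurability\<close>

lemma gen_events_subset: "gen_events M X I \<subseteq> Pow (space M)"
  by (auto simp: gen_events_def)

lemma gen_events_mono: "I \<subseteq> J \<Longrightarrow> gen_events M X I \<subseteq> gen_events M X J"
  by (auto simp: gen_events_def)

lemma space_filtr [simp]: "space (filtr M Q D E t) = space M"
  unfolding filtr_def by (rule space_measure_of) (simp add: gen_events_subset)

lemma sets_filtr:
  "sets (filtr M Q D E t) = sigma_sets (space M)
     (gen_events M Q {s. int s \<le> t} \<union> gen_events M D {s. int s \<le> t} \<union> gen_events M E {s. int s \<le> t})"
  unfolding filtr_def by (rule sets_measure_of) (simp add: gen_events_subset)

lemma sets_filtr_mono: "s \<le> t \<Longrightarrow> sets (filtr M Q D E s) \<subseteq> sets (filtr M Q D E t)"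
  unfolding sets_filtr by (intro sigma_sets_mono' Un_mono gen_events_mono) auto

lemma subalgebra_filtr:
  assumes "\<And>t. Q t \<in> borel_measurable M" "\<And>t. D t \<in> borel_measurable M" "\<And>t. E t \<in> borel_measurable M"
  shows "subalgebra M (filtr M Q D E t)"
  unfolding subalgebra_def sets_filtr
proof (intro conjI sets.sigma_sets_subset)
  show "gen_events M Q {s. int s \<le> t} \<union> gen_events M D {s. int s \<le> t} \<union> gen_events M E {s. int s \<le> t} \<subseteq> sets M"
    using assms by (auto simp: gen_events_def intro!: measurable_sets)
qed simp

lemma gen_events_measurable:
  fixes X :: "'i \<Rightarrow> 'a \<Rightarrow> 'b::topological_space"
  assumes "gen_events M X I \<subseteq> sets N" "space N = space M" "i \<in> I"
  shows "X i \<in> borel_measurable N"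
proof (rule measurableI)
  fix A :: "'b set" assume "A \<in> sets borel"
  then have "X i -` A \<inter> space M \<in> gen_events M X I" using assms(3) by (auto simp: gen_events_def)
  then show "X i -` A \<inter> space N \<in> sets N" using assms by auto
qed simp

lemma borel_measurable_filtr:
  assumes "int s \<le> t"
  shows "Q s \<in> borel_measurable (filtr M Q D E t)" "D s \<in> borel_measurable (filtr M Q D E t)"
    "E s \<in> borel_measurable (filtr M Q D E t)"
  using assms
  by (auto intro!: gen_events_measurable[where I = "{s. int s \<le> t}" and M = M] sigma_sets.Basic simp: sets_filtr)

section \<open>The recursion: adaptedness, pathwise bounds and second moments\<close>

locale linear_recursion = prob_space M for M :: "'a measure" +
  fixes Q D :: "nat \<Rightarrow> 'a \<Rightarrow> real^'q^'q"
    and E1 E2 e :: "nat \<Rightarrow> 'a \<Rightarrow> real^'q"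
    and \<alpha> g1 g2 :: "nat \<Rightarrow> real"
    and e0 :: "real^'q"
    and \<alpha>0 \<pi>1 lam c\<epsilon> \<delta> :: real and h :: nat
  assumes meas_Q [measurable]: "\<And>t. Q t \<in> borel_measurable M"
    and meas_D [measurable]: "\<And>t. D t \<in> borel_measurable M"
    and meas_E1 [measurable]: "\<And>t. E1 t \<in> borel_measurable M"
    and e_0: "\<And>\<omega>. e 0 \<omega> = e0"
    and e_Suc: "\<And>t \<omega>. e (Suc t) \<omega> = e t \<omega> + \<alpha> t *\<^sub>R ((Q t \<omega> + D t \<omega>) *v e t \<omega>)
                                     + \<alpha> t *\<^sub>R (E1 t \<omega> + E2 t \<omega>)"
    and \<alpha>_pos: "\<And>t. \<alpha> t > 0"
    and \<alpha>_lim: "\<alpha> \<longlonglongrightarrow> 0"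
    and \<alpha>_nsum: "\<not> summable \<alpha>"
    and \<alpha>_inv: "(\<lambda>t. 1 / \<alpha> (Suc t) - 1 / \<alpha> t) \<longlonglongrightarrow> \<alpha>0"
    and Q_bdd: "AE \<omega> in M. \<forall>t. mnorm (Q t \<omega>) \<le> \<pi>1"
    and h_pos: "h > 0" and lam_pos: "lam > 0"
    and Q_neg: "\<And>m. AE \<omega> in M.
        lambda_max (\<Sum>t\<in>{m*h..<(m+1)*h}.
           cond_exp_mat M (filtr M Q D E1 (int (m*h) - 1)) (\<lambda>x. Q t x + transpose (Q t x)) \<omega>) \<le> - lam"
    and D_bdd: "\<And>t. AE \<omega> in M. mnorm (D t \<omega>) \<le> g1 t"
    and g1_lim: "g1 \<longlonglongrightarrow> 0" and g1_bdd: "bdd_above (range g1)"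
    and E1_mds: "\<And>t. AE \<omega> in M. cond_exp_vec M (filtr M Q D E1 (int t - 1)) (E1 t) \<omega> = 0"
    and \<delta>: "\<delta> < 1/2" and c\<epsilon>: "c\<epsilon> > 0"
    and E1_var: "\<And>t. AE \<omega> in M.
        nn_cond_exp M (filtr M Q D E1 (int t - 1)) (\<lambda>x. ennreal ((norm (\<alpha> t powr \<delta> *\<^sub>R E1 t x))\<^sup>2)) \<omega>
          \<le> ennreal c\<epsilon>"
    and meas_E2: "\<And>t. E2 t \<in> borel_measurable (filtr M Q D E1 (int t))"
    and E2_bdd: "\<And>t. AE \<omega> in M. norm (E2 t \<omega>) \<le> g2 t"
    and g2_lim: "g2 \<longlonglongrightarrow> 0" and g2_bdd: "bdd_above (range g2)"
begin

text \<open>The index is shifted: \<open>G t\<close> is \<open>F(t - 1)\<close>, so that \<open>e t\<close> is \<open>G t\<close>-measurable.\<close>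

definition G :: "nat \<Rightarrow> 'a measure" where "G t = filtr M Q D E1 (int t - 1)"

lemma subalgebra_G: "subalgebra M (G t)"
  unfolding G_def by (intro subalgebra_filtr meas_Q meas_D meas_E1)

lemma subalgebra_G_mono: "s \<le> t \<Longrightarrow> subalgebra (G t) (G s)"
  unfolding subalgebra_def G_def by (simp add: sets_filtr_mono)

lemma finite_measure_subalgebra_G: "finite_measure_subalgebra M (G t)"
  by unfold_locales (rule subalgebra_G)

lemma measurable_G_Suc:
  "Q t \<in> borel_measurable (G (Suc t))" "D t \<in> borel_measurable (G (Suc t))"
  "E1 t \<in> borel_measurable (G (Suc t))" "E2 t \<in> borel_measurable (G (Suc t))"
  using meas_E2[of t] unfolding G_def by (simp_all add: borel_measurable_filtr)

lemma e_adapted: "e t \<in> borel_measurable (G t)"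
proof (induction t)
  case 0
  \<comment> \<open>\<open>G 0\<close> is generated by no events, so measurability here rests on the
    initial value being deterministic.\<close>
  have "e 0 = (\<lambda>_. e0)" by (rule ext) (rule e_0)
  then show ?case by simp
next
  case (Suc t)
  have [measurable]: "e t \<in> borel_measurable (G (Suc t))"
    by (rule measurable_from_subalg[OF subalgebra_G_mono Suc]) simp
  note [measurable] = measurable_G_Suc[of t]
  have "e (Suc t) = (\<lambda>\<omega>. e t \<omega> + \<alpha> t *\<^sub>R ((Q t \<omega> + D t \<omega>) *v e t \<omega>) + \<alpha> t *\<^sub>R (E1 t \<omega> + E2 t \<omega>))"
    by (rule ext) (rule e_Suc)
  then show ?case by simp
qed

lemma meas_e [measurable]: "e t \<in> borel_measurable M"
  by (rule measurable_from_subalg[OF subalgebra_G e_adapted])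

lemma g1_nonneg: "0 \<le> g1 t"
proof -
  have "AE \<omega> in M. 0 \<le> g1 t" using D_bdd[of t] by eventually_elim (rule order.trans[OF mnorm_nonneg])
  then show ?thesis by simp
qed

lemma g2_nonneg: "0 \<le> g2 t"
proof -
  have "AE \<omega> in M. 0 \<le> g2 t" using E2_bdd[of t] by eventually_elim (rule order.trans[OF norm_ge_zero])
  then show ?thesis by simp
qed

definition "b1 = (SUP t. g1 t)"
definition "b2 = (SUP t. g2 t)"

lemma g1_le: "g1 t \<le> b1"
  unfolding b1_def by (rule cSUP_upper[OF _ g1_bdd]) simp

lemma g2_le: "g2 t \<le> b2"
  unfolding b2_def by (rule cSUP_upper[OF _ g2_bdd]) simp

lemma b_nonneg: "0 \<le> b1" "0 \<le> b2"
  using g1_nonneg[of 0] g1_le[of 0] g2_nonneg[of 0] g2_le[of 0] by simp_all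

text \<open>\<open>K\<close> has to dominate both \<open>\<bar>\<pi>1\<bar> + b1\<close>, for the
  full matrix of one step, and \<open>real h * b1\<close>, which bounds the block sum
  \<open>\<kappa> m\<close>; hence the factor \<open>h\<close>. The absolute value gives
  nonnegativity without a sign condition on \<open>\<pi>1\<close>.\<close>

definition "K = \<bar>\<pi>1\<bar> + real h * b1"

lemma K_nonneg: "0 \<le> K" using b_nonneg by (simp add: K_def)

lemma \<pi>1_b1_le_K: "\<bar>\<pi>1\<bar> + b1 \<le> K"
proof -
  have "1 * b1 \<le> real h * b1" using h_pos b_nonneg by (intro mult_right_mono) auto
  then show ?thesis by (simp add: K_def)
qed

text \<open>Collects the almost sure bounds for all times at once, so that the deterministic block
  estimates apply outside a single null set.\<close>

definition bounded_path :: "'a \<Rightarrow> bool" where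
  "bounded_path \<omega> \<longleftrightarrow> (\<forall>t. mnorm (Q t \<omega>) \<le> \<pi>1 \<and> mnorm (D t \<omega>) \<le> g1 t \<and> norm (E2 t \<omega>) \<le> g2 t)"

lemma AE_bounded_path: "AE \<omega> in M. bounded_path \<omega>"
proof -
  have "AE \<omega> in M. \<forall>t. mnorm (D t \<omega>) \<le> g1 t" "AE \<omega> in M. \<forall>t. norm (E2 t \<omega>) \<le> g2 t"
    unfolding AE_all_countable using D_bdd E2_bdd by auto
  with Q_bdd show ?thesis by eventually_elim (simp add: bounded_path_def)
qed

lemma bounded_pathD:
  assumes "bounded_path \<omega>"
  shows "norm (Q t \<omega> *v z) \<le> K * norm z" "norm (D t \<omega> *v z) \<le> g1 t * norm z"
    "norm ((Q t \<omega> + D t \<omega>) *v z) \<le> K * norm z" "norm (E2 t \<omega>) \<le> g2 t"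
proof -
  have Q: "mnorm (Q t \<omega>) \<le> \<bar>\<pi>1\<bar>" and D: "mnorm (D t \<omega>) \<le> g1 t" and E: "norm (E2 t \<omega>) \<le> g2 t"
    using assms abs_ge_self[of \<pi>1] unfolding bounded_path_def by (auto intro: order.trans)
  have Qz: "norm (Q t \<omega> *v z) \<le> \<bar>\<pi>1\<bar> * norm z"
    by (rule order.trans[OF norm_matrix_vector_le_mnorm mult_right_mono[OF Q]]) simp
  show Dz: "norm (D t \<omega> *v z) \<le> g1 t * norm z"
    by (rule order.trans[OF norm_matrix_vector_le_mnorm mult_right_mono[OF D]]) simp
  have "norm ((Q t \<omega> + D t \<omega>) *v z) \<le> \<bar>\<pi>1\<bar> * norm z + g1 t * norm z"
    unfolding matrix_vector_mult_add_rdistrib by (intro norm_triangle_le add_mono Qz Dz)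
  also have "\<dots> = (\<bar>\<pi>1\<bar> + g1 t) * norm z" by (simp add: distrib_right)
  also have "\<dots> \<le> K * norm z" using \<pi>1_b1_le_K g1_le[of t] by (intro mult_right_mono) auto
  finally show "norm ((Q t \<omega> + D t \<omega>) *v z) \<le> K * norm z" .
  have "\<bar>\<pi>1\<bar> * norm z \<le> K * norm z" using \<pi>1_b1_le_K b_nonneg by (intro mult_right_mono) auto
  with Qz show "norm (Q t \<omega> *v z) \<le> K * norm z" by simp
  show "norm (E2 t \<omega>) \<le> g2 t" by fact
qed

text \<open>The conditional bound uses \<open>nn_cond_exp\<close>, which makes sense before square
  integrability is known; integrating it yields that integrability. Splitting
  \<open>(\<alpha> t)\<^sup>2\<close> into the powers with exponents
  \<open>2 * (1 - \<delta>)\<close> and \<open>2 * \<delta>\<close> then gives the stated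
  rate.\<close>

lemma E1_second_moment:
  shows integrable_E1: "integrable M (\<lambda>\<omega>. (norm (E1 t \<omega>))\<^sup>2)"
    and integral_E1_le: "(\<alpha> t)\<^sup>2 * (\<integral>\<omega>. (norm (E1 t \<omega>))\<^sup>2 \<partial>M) \<le> c\<epsilon> * \<alpha> t powr (2 * (1 - \<delta>))"
proof -
  interpret G: finite_measure_subalgebra M "G t" by (rule finite_measure_subalgebra_G)
  let ?g = "\<lambda>\<omega>. (norm (\<alpha> t powr \<delta> *\<^sub>R E1 t \<omega>))\<^sup>2"
  have "(\<integral>\<^sup>+\<omega>. ennreal (?g \<omega>) \<partial>M) = (\<integral>\<^sup>+\<omega>. 1 * nn_cond_exp M (G t) (\<lambda>x. ennreal (?g x)) \<omega> \<partial>M)"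
    by (subst G.nn_cond_exp_intg) auto
  also have "\<dots> \<le> (\<integral>\<^sup>+\<omega>. ennreal c\<epsilon> \<partial>M)"
    using E1_var[of t] by (intro nn_integral_mono_AE) (simp add: G_def)
  also have "\<dots> = ennreal c\<epsilon>" by (simp add: emeasure_space_1)
  finally have le: "(\<integral>\<^sup>+\<omega>. ennreal (?g \<omega>) \<partial>M) \<le> ennreal c\<epsilon>" .
  have int: "integrable M ?g"
    by (rule integrableI_nonneg) (use le in \<open>auto intro: le_less_trans\<close>)
  have g_le: "(\<integral>\<omega>. ?g \<omega> \<partial>M) \<le> c\<epsilon>"
    using le c\<epsilon> nn_integral_eq_integral[OF int] by simp
  define p where "p = (\<alpha> t powr \<delta>)\<^sup>2"
  have p: "p > 0" using \<alpha>_pos[of t] by (simp add: p_def)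
  have g: "?g \<omega> = p * (norm (E1 t \<omega>))\<^sup>2" for \<omega> by (simp add: p_def power_mult_distrib)
  have "integrable M (\<lambda>\<omega>. (1 / p) * ?g \<omega>)" by (rule integrable_mult_right[OF int])
  then show "integrable M (\<lambda>\<omega>. (norm (E1 t \<omega>))\<^sup>2)" unfolding g using p by simp
  have "\<alpha> t powr (2 * (1 - \<delta>)) * p = \<alpha> t powr (2 * (1 - \<delta>)) * \<alpha> t powr (\<delta> + \<delta>)"
    by (simp only: p_def power2_eq_square powr_add)
  also have "\<dots> = (\<alpha> t)\<^sup>2" unfolding powr_add[symmetric] using \<alpha>_pos[of t] by (simp add: powr_numeral)
  finally have "(\<alpha> t)\<^sup>2 * (\<integral>\<omega>. (norm (E1 t \<omega>))\<^sup>2 \<partial>M)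
      = \<alpha> t powr (2 * (1 - \<delta>)) * (p * (\<integral>\<omega>. (norm (E1 t \<omega>))\<^sup>2 \<partial>M))"
    by (simp add: mult_ac)
  also have "\<dots> \<le> \<alpha> t powr (2 * (1 - \<delta>)) * c\<epsilon>"
    using g_le unfolding g by (intro mult_left_mono) auto
  finally show "(\<alpha> t)\<^sup>2 * (\<integral>\<omega>. (norm (E1 t \<omega>))\<^sup>2 \<partial>M) \<le> c\<epsilon> * \<alpha> t powr (2 * (1 - \<delta>))"
    by (simp add: mult.commute)
qed

lemma integrable_e: "integrable M (\<lambda>\<omega>. (norm (e t \<omega>))\<^sup>2)"
proof (induction t)
  case 0
  show ?case by (simp add: e_0)
next
  case (Suc t)
  let ?b = "\<lambda>\<omega>. 3 * (((1 + \<alpha> t * K) * norm (e t \<omega>))\<^sup>2 + (\<alpha> t * norm (E1 t \<omega>))\<^sup>2 + (\<alpha> t * b2)\<^sup>2)"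
  show ?case
  proof (rule Bochner_Integration.integrable_bound)
    show "integrable M ?b"
      unfolding power_mult_distrib
      by (intro integrable_mult_right Bochner_Integration.integrable_add Suc integrable_E1) simp
    show "AE \<omega> in M. norm ((norm (e (Suc t) \<omega>))\<^sup>2) \<le> norm (?b \<omega>)"
      using AE_bounded_path
    proof eventually_elim
      case (elim \<omega>)
      have "norm (e (Suc t) \<omega>) \<le> norm (e t \<omega>) + \<alpha> t * (K * norm (e t \<omega>)) + \<alpha> t * (norm (E1 t \<omega>) + b2)"
        unfolding e_Suc using \<alpha>_pos[of t] bounded_pathD(3)[OF elim, of t "e t \<omega>"]
          order.trans[OF bounded_pathD(4)[OF elim, of t] g2_le]
        by (intro norm_triangle_le add_mono) (auto intro!: norm_triangle_le)
      also have "\<dots> = (1 + \<alpha> t * K) * norm (e t \<omega>) + \<alpha> t * norm (E1 t \<omega>) + \<alpha> t * b2"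
        by (simp add: algebra_simps)
      finally have "(norm (e (Suc t) \<omega>))\<^sup>2 \<le> ((1 + \<alpha> t * K) * norm (e t \<omega>) + \<alpha> t * norm (E1 t \<omega>) + \<alpha> t * b2)\<^sup>2"
        by (rule power_mono) simp
      also have "\<dots> \<le> ?b \<omega>" by (rule square_sum3_le)
      finally show ?case by simp
    qed
  qed measurable
qed

section \<open>Block quantities and their limits\<close>

definition "a m = \<alpha> (m * h)"
text \<open>Block sums are used for \<open>\<eta>\<close>, \<open>\<kappa>\<close> and
  \<open>\<rho>\<close> instead of maxima: having nonnegative terms they dominate each one, and
  their limits follow term by term.\<close>

definition "\<eta> m = (\<Sum>k<h. \<bar>\<alpha> (m * h + k) / \<alpha> (m * h) - 1\<bar>)"
definition "\<kappa> m = (\<Sum>k<h. g1 (m * h + k))"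
definition "\<rho> m = (\<Sum>k<h. g2 (m * h + k))"
definition "\<theta> m = a m + \<kappa> m + \<eta> m + \<rho> m"
definition "N m \<omega> = (\<Sum>k<h. (\<alpha> (m * h + k))\<^sup>2 * (norm (E1 (m * h + k) \<omega>))\<^sup>2)"
definition "\<nu> m = (\<Sum>k<h. \<alpha> (m * h + k) powr (2 * (1 - \<delta>)))"
definition "V m \<omega> = (norm (e (m * h) \<omega>))\<^sup>2"
text \<open>Holds for all late blocks. The bound on \<open>\<eta> m\<close> keeps the step sizes of
  the block within a factor 2 of the first one, in both directions; \<open>a m \<le> 1\<close>
  absorbs higher powers of the step size.\<close>

definition "regular m \<longleftrightarrow> a m \<le> 1 \<and> \<eta> m \<le> 1 / 2"

lemma a_pos: "a m > 0" by (simp add: a_def \<alpha>_pos)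

lemma \<rho>_nonneg: "\<rho> m \<ge> 0" unfolding \<rho>_def by (intro sum_nonneg g2_nonneg)

lemma \<nu>_nonneg: "\<nu> m \<ge> 0" unfolding \<nu>_def by (intro sum_nonneg) simp

lemma \<rho>_le: "\<rho> m \<le> real h * b2"
  unfolding \<rho>_def using sum_bounded_above[of "{..<h}" "\<lambda>k. g2 (m * h + k)" b2] g2_le by simp

lemma a_tendsto: "a \<longlonglongrightarrow> 0"
  using tendsto_block_index[OF \<alpha>_lim h_pos, of 0] by (simp add: a_def[abs_def])

lemma \<eta>_tendsto: "\<eta> \<longlonglongrightarrow> 0"
  unfolding \<eta>_def
proof (rule tendsto_null_sum)
  fix k
  \<comment> \<open>The offset 0 matches \<open>tendsto_block_index\<close>, applied to the ratio
    sequence along the block starts.\<close>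
  have "(\<lambda>m. \<alpha> (m * h + 0 + k) / \<alpha> (m * h + 0)) \<longlonglongrightarrow> 1"
    by (rule tendsto_block_index[OF step_ratio_tendsto_1[OF \<alpha>_pos \<alpha>_lim \<alpha>_inv] h_pos])
  from tendsto_rabs[OF tendsto_diff[OF this tendsto_const[of 1]]]
  show "(\<lambda>m. \<bar>\<alpha> (m * h + k) / \<alpha> (m * h) - 1\<bar>) \<longlonglongrightarrow> 0" by simp
qed

lemma \<kappa>_tendsto: "\<kappa> \<longlonglongrightarrow> 0"
  unfolding \<kappa>_def by (intro tendsto_null_sum tendsto_block_index g1_lim h_pos)

lemma \<rho>_tendsto: "\<rho> \<longlonglongrightarrow> 0"
  unfolding \<rho>_def by (intro tendsto_null_sum tendsto_block_index g2_lim h_pos)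

lemma \<theta>_tendsto: "\<theta> \<longlonglongrightarrow> 0"
proof -
  have "\<theta> \<longlonglongrightarrow> 0 + 0 + 0 + 0"
    unfolding \<theta>_def by (intro tendsto_add a_tendsto \<kappa>_tendsto \<eta>_tendsto \<rho>_tendsto)
  then show ?thesis by simp
qed

lemma step_ratio_le:
  assumes "k < h"
  shows "\<bar>\<alpha> (m * h + k) - a m\<bar> \<le> \<eta> m * a m"
proof -
  have "\<bar>\<alpha> (m * h + k) / \<alpha> (m * h) - 1\<bar> \<le> \<eta> m"
    unfolding \<eta>_def using assms by (intro member_le_sum) auto
  then have "\<bar>\<alpha> (m * h + k) / \<alpha> (m * h) - 1\<bar> * a m \<le> \<eta> m * a m"
    using a_pos[of m] by (intro mult_right_mono) auto
  moreover have "\<bar>\<alpha> (m * h + k) / \<alpha> (m * h) - 1\<bar> * a m = \<bar>(\<alpha> (m * h + k) / \<alpha> (m * h) - 1) * a m\<bar>"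
    using a_pos[of m] by (simp add: abs_mult)
  ultimately show ?thesis using less_imp_neq[OF \<alpha>_pos[of "m * h"]] by (simp add: a_def left_diff_distrib)
qed

lemma step_le:
  assumes "regular m" "k < h"
  shows "\<alpha> (m * h + k) \<le> 2 * a m" "a m \<le> 2 * \<alpha> (m * h + k)"
proof -
  have "\<eta> m * a m \<le> 1 / 2 * a m"
    using assms(1) a_pos[of m] by (intro mult_right_mono) (auto simp: regular_def)
  with step_ratio_le[OF assms(2), of m] a_pos[of m]
  show "\<alpha> (m * h + k) \<le> 2 * a m" "a m \<le> 2 * \<alpha> (m * h + k)" by linarith+
qed

lemma eventually_regular: "\<forall>\<^sub>F m in sequentially. regular m"
proof -
  have "\<forall>\<^sub>F m in sequentially. a m < 1" "\<forall>\<^sub>F m in sequentially. \<eta> m < 1 / 2"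
    by (rule order_tendstoD(2)[OF a_tendsto], simp) (rule order_tendstoD(2)[OF \<eta>_tendsto], simp)
  then show ?thesis by eventually_elim (simp add: regular_def)
qed

text \<open>The exponent \<open>2 * (1 - \<delta>)\<close> exceeds 1 by
  \<open>1 - 2 * \<delta>\<close>, which is positive because \<open>\<delta> < 1/2\<close>. So the
  noise variance of a block is of smaller order than its step size.\<close>

lemma \<nu>_div_a_tendsto: "(\<lambda>m. \<nu> m / a m) \<longlonglongrightarrow> 0"
proof -
  have "(\<lambda>t. \<alpha> t powr (1 - 2 * \<delta>)) \<longlonglongrightarrow> 0"
    using \<delta> \<alpha>_pos by (intro tendsto_zero_powrI[OF \<alpha>_lim tendsto_const]) (auto simp: less_imp_le)
  then have "(\<lambda>m. \<alpha> (m * h + k) powr (1 - 2 * \<delta>)) \<longlonglongrightarrow> 0" for k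
    by (rule tendsto_block_index) (rule h_pos)
  then have lim: "(\<lambda>m. \<Sum>k<h. 2 * \<alpha> (m * h + k) powr (1 - 2 * \<delta>)) \<longlonglongrightarrow> 0"
    by (intro tendsto_null_sum tendsto_mult_right_zero)
  show ?thesis
  proof (rule tendsto_sandwich[OF _ _ tendsto_const lim])
    show "\<forall>\<^sub>F m in sequentially. 0 \<le> \<nu> m / a m"
      using \<nu>_nonneg a_pos by (simp add: less_imp_le)
    show "\<forall>\<^sub>F m in sequentially. \<nu> m / a m \<le> (\<Sum>k<h. 2 * \<alpha> (m * h + k) powr (1 - 2 * \<delta>))"
      using eventually_regular
    proof eventually_elim
      case (elim m)
      have "\<nu> m \<le> (\<Sum>k<h. 2 * \<alpha> (m * h + k) powr (1 - 2 * \<delta>)) * a m"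
        unfolding \<nu>_def sum_distrib_right
      proof (intro sum_mono)
        fix k assume "k \<in> {..<h}"
        then have "\<alpha> (m * h + k) \<le> 2 * a m" using step_le[OF elim] by simp
        have "\<alpha> (m * h + k) powr (2 * (1 - \<delta>)) = \<alpha> (m * h + k) powr ((1 - 2 * \<delta>) + 1)"
          by (simp add: algebra_simps)
        also have "\<dots> = \<alpha> (m * h + k) powr (1 - 2 * \<delta>) * \<alpha> (m * h + k)"
          using \<alpha>_pos[of "m * h + k"] by (simp only: powr_add powr_one less_imp_le)
        also have "\<dots> \<le> \<alpha> (m * h + k) powr (1 - 2 * \<delta>) * (2 * a m)"
          by (intro mult_left_mono) (fact, simp)
        finally show "\<alpha> (m * h + k) powr (2 * (1 - \<delta>)) \<le> 2 * \<alpha> (m * h + k) powr (1 - 2 * \<delta>) * a m"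
          by (simp add: mult_ac)
      qed
      then show ?case using a_pos[of m] by (simp add: pos_divide_le_eq)
    qed
  qed
qed

lemma \<nu>_tendsto: "\<nu> \<longlonglongrightarrow> 0"
proof -
  have "(\<lambda>m. \<nu> m / a m * a m) \<longlonglongrightarrow> 0 * 0" by (intro tendsto_mult \<nu>_div_a_tendsto a_tendsto)
  moreover have "\<nu> m / a m * a m = \<nu> m" for m using a_pos[of m] by simp
  ultimately show ?thesis by simp
qed

lemma a_not_summable: "\<not> summable a"
proof
  assume "summable a"
  then have *: "summable (\<lambda>m. real h * (2 * a m))" by (intro summable_mult)
  have "summable (\<lambda>m. \<Sum>k<h. \<alpha> (m * h + k))"
  proof (rule summable_comparison_test_ev[OF _ *])
    show "\<forall>\<^sub>F m in sequentially. norm (\<Sum>k<h. \<alpha> (m * h + k)) \<le> real h * (2 * a m)"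
      using eventually_regular
    proof eventually_elim
      case (elim m)
      have "0 \<le> (\<Sum>k<h. \<alpha> (m * h + k))" by (intro sum_nonneg less_imp_le \<alpha>_pos)
      moreover have "(\<Sum>k<h. \<alpha> (m * h + k)) \<le> (\<Sum>k<h. 2 * a m)"
        using step_le(1)[OF elim] by (intro sum_mono) simp
      ultimately show ?case by simp
    qed
  qed
  then show False using \<alpha>_nsum summable_blocks[of \<alpha> h] \<alpha>_pos h_pos by (simp add: less_imp_le)
qed

section \<open>Pathwise estimates over one block\<close>

lemma perturbed_block_path:
  assumes \<omega>: "bounded_path \<omega>" and m: "regular m"
  shows "perturbed_block (\<lambda>k z. (Q (m * h + k) \<omega> + D (m * h + k) \<omega>) *v z) (\<lambda>k z. Q (m * h + k) \<omega> *v z)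
    (\<lambda>k. e (m * h + k) \<omega>) (\<lambda>k. E1 (m * h + k) \<omega>) (\<lambda>k. E2 (m * h + k) \<omega>)
    (\<lambda>k. \<alpha> (m * h + k)) (a m) (\<kappa> m) (\<eta> m) (\<rho> m) K h"
proof (rule perturbed_block.intro)
  show "e (m * h + Suc k) \<omega> = e (m * h + k) \<omega> + \<alpha> (m * h + k) *\<^sub>R
    ((Q (m * h + k) \<omega> + D (m * h + k) \<omega>) *v e (m * h + k) \<omega> + E1 (m * h + k) \<omega> + E2 (m * h + k) \<omega>)" for k
    using e_Suc[of "m * h + k" \<omega>] by (simp add: scaleR_add_right add.assoc)
  show "linear ((*v) (Q (m * h + k) \<omega> + D (m * h + k) \<omega>))" for k by simp
  show "norm ((Q (m * h + k) \<omega> + D (m * h + k) \<omega>) *v z) \<le> K * norm z" for k z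
    by (rule bounded_pathD[OF \<omega>])
  show "norm (Q (m * h + k) \<omega> *v z) \<le> K * norm z" for k z
    by (rule bounded_pathD[OF \<omega>])
  show "norm ((Q (m * h + k) \<omega> + D (m * h + k) \<omega>) *v z - Q (m * h + k) \<omega> *v z) \<le> \<kappa> m * norm z"
    if "k < h" for k z
  proof -
    have "g1 (m * h + k) \<le> \<kappa> m"
      unfolding \<kappa>_def using that g1_nonneg by (intro member_le_sum) auto
    then have "g1 (m * h + k) * norm z \<le> \<kappa> m * norm z" by (intro mult_right_mono) auto
    with bounded_pathD(2)[OF \<omega>, of "m * h + k" z] show ?thesis
      by (simp add: matrix_vector_mult_add_rdistrib)
  qed
  show "norm (E2 (m * h + k) \<omega>) \<le> \<rho> m" if "k < h" for k
  proof -
    have "g2 (m * h + k) \<le> \<rho> m"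
      unfolding \<rho>_def using that g2_nonneg by (intro member_le_sum) auto
    with bounded_pathD(4)[OF \<omega>, of "m * h + k"] show ?thesis by simp
  qed
  show "0 \<le> \<alpha> (m * h + k)" for k by (simp add: \<alpha>_pos less_imp_le)
  show "\<alpha> (m * h + k) \<le> 2 * a m" if "k < h" for k by (rule step_le[OF m that])
  show "\<bar>\<alpha> (m * h + k) - a m\<bar> \<le> \<eta> m * a m" if "k < h" for k by (rule step_ratio_le[OF that])
  show "0 \<le> a m" "a m \<le> 1" "\<eta> m \<le> 1" using a_pos[of m] m by (auto simp: regular_def)
  show "0 \<le> K" by (rule K_nonneg)
  show "0 \<le> \<rho> m" by (rule \<rho>_nonneg)
  show "0 \<le> \<kappa> m" unfolding \<kappa>_def by (intro sum_nonneg g1_nonneg)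
  show "0 \<le> \<eta> m" unfolding \<eta>_def by (intro sum_nonneg) simp
  have "\<kappa> m \<le> real h * b1"
    unfolding \<kappa>_def using sum_bounded_above[of "{..<h}" "\<lambda>k. g1 (m * h + k)" b1] g1_le by simp
  then show "\<kappa> m \<le> K" by (simp add: K_def)
qed

definition "CE = expansion_const K h (real h * b2)"
definition "CG = 3 * (1 + growth_const K h)\<^sup>2 * (1 + real h * b2)"

lemma CE_nonneg: "CE \<ge> 0"
proof -
  have "rest_const K h \<ge> 0"
    using growth_const_ge_1[OF K_nonneg, of h] K_nonneg by (simp add: rest_const_def)
  then show ?thesis using b_nonneg by (simp add: CE_def expansion_const_def)
qed

lemma CG_nonneg: "CG \<ge> 0"
  using b_nonneg by (simp add: CG_def)

lemma N_nonneg: "N m \<omega> \<ge> 0"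
  unfolding N_def by (intro sum_nonneg) simp

text \<open>The first order expansion with \<open>P\<^sup>2\<close> replaced by
  \<open>real h * N m \<omega>\<close> through Cauchy-Schwarz, since the mean of \<open>N m\<close>
  is at hand.\<close>

lemma V_Suc_le:
  assumes \<omega>: "bounded_path \<omega>" and m: "regular m"
  shows "V (Suc m) \<omega> \<le> V m \<omega> + 2 * a m * (e (m * h) \<omega> \<bullet> (\<Sum>k<h. Q (m * h + k) \<omega> *v e (m * h) \<omega>))
    + 2 * (\<Sum>k<h. \<alpha> (m * h + k) * (e (m * h) \<omega> \<bullet> E1 (m * h + k) \<omega>))
    + CE * (a m * \<theta> m * V m \<omega> + real h * N m \<omega> + a m * \<rho> m)"
proof -
  interpret blk: perturbed_block "\<lambda>k z. (Q (m * h + k) \<omega> + D (m * h + k) \<omega>) *v z" "\<lambda>k z. Q (m * h + k) \<omega> *v z"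
    "\<lambda>k. e (m * h + k) \<omega>" "\<lambda>k. E1 (m * h + k) \<omega>" "\<lambda>k. E2 (m * h + k) \<omega>"
    "\<lambda>k. \<alpha> (m * h + k)" "a m" "\<kappa> m" "\<eta> m" "\<rho> m" K h
    by (rule perturbed_block_path[OF assms])
  have "CE * (a m * \<theta> m * V m \<omega> + blk.P\<^sup>2 + a m * \<rho> m)
      \<le> CE * (a m * \<theta> m * V m \<omega> + real h * N m \<omega> + a m * \<rho> m)"
    using CE_nonneg blk.P_squared_le by (intro mult_left_mono add_left_mono add_right_mono) (auto simp: N_def)
  moreover have "(norm (e (m * h + h) \<omega>))\<^sup>2
    \<le> V m \<omega> + 2 * a m * (e (m * h) \<omega> \<bullet> (\<Sum>k<h. Q (m * h + k) \<omega> *v e (m * h) \<omega>))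
      + 2 * (\<Sum>k<h. \<alpha> (m * h + k) * (e (m * h) \<omega> \<bullet> E1 (m * h + k) \<omega>))
      + CE * (a m * \<theta> m * V m \<omega> + blk.P\<^sup>2 + a m * \<rho> m)"
    using blk.norm_square_expansion[OF \<rho>_le] by (simp add: V_def \<theta>_def CE_def)
  moreover have "V (Suc m) \<omega> = (norm (e (m * h + h) \<omega>))\<^sup>2" by (simp add: V_def add.commute)
  ultimately show ?thesis by linarith
qed

lemma norm_e_block_le:
  assumes \<omega>: "bounded_path \<omega>" and m: "regular m" and k: "k \<le> h"
  shows "(norm (e (m * h + k) \<omega>))\<^sup>2 \<le> CG * (V m \<omega> + real h * N m \<omega> + a m * \<rho> m)"
proof -
  interpret blk: perturbed_block "\<lambda>k z. (Q (m * h + k) \<omega> + D (m * h + k) \<omega>) *v z" "\<lambda>k z. Q (m * h + k) \<omega> *v z"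
    "\<lambda>k. e (m * h + k) \<omega>" "\<lambda>k. E1 (m * h + k) \<omega>" "\<lambda>k. E2 (m * h + k) \<omega>"
    "\<lambda>k. \<alpha> (m * h + k)" "a m" "\<kappa> m" "\<eta> m" "\<rho> m" K h
    by (rule perturbed_block_path[OF \<omega> m])
  have "CG * (V m \<omega> + blk.P\<^sup>2 + a m * \<rho> m) \<le> CG * (V m \<omega> + real h * N m \<omega> + a m * \<rho> m)"
    using CG_nonneg blk.P_squared_le by (intro mult_left_mono add_left_mono add_right_mono) (auto simp: N_def)
  then show ?thesis using blk.norm_square_le[OF \<rho>_le k] by (simp add: V_def CG_def)
qed

section \<open>Integrated contraction and mean square convergence\<close>

lemma integrable_V: "integrable M (V m)"
  unfolding V_def[abs_def] by (rule integrable_e)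

lemma integrable_N: "integrable M (N m)"
  unfolding N_def[abs_def] by (intro Bochner_Integration.integrable_sum integrable_mult_right integrable_E1)

lemma integral_N_le: "(\<integral>\<omega>. N m \<omega> \<partial>M) \<le> c\<epsilon> * \<nu> m"
proof -
  have "(\<integral>\<omega>. N m \<omega> \<partial>M) = (\<Sum>k<h. (\<alpha> (m * h + k))\<^sup>2 * (\<integral>\<omega>. (norm (E1 (m * h + k) \<omega>))\<^sup>2 \<partial>M))"
    unfolding N_def by (simp add: Bochner_Integration.integral_sum integrable_E1)
  also have "\<dots> \<le> (\<Sum>k<h. c\<epsilon> * \<alpha> (m * h + k) powr (2 * (1 - \<delta>)))"
    by (intro sum_mono integral_E1_le)
  finally show ?thesis by (simp add: \<nu>_def sum_distrib_left)
qed

definition "\<gamma> m = CE * (real h * c\<epsilon> * \<nu> m + a m * \<rho> m)"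

lemma \<gamma>_nonneg: "\<gamma> m \<ge> 0"
  unfolding \<gamma>_def using CE_nonneg c\<epsilon> \<nu>_nonneg[of m] \<rho>_nonneg[of m] a_pos[of m] by simp

text \<open>Integrating over every event \<open>A\<close> of the past expresses a conditional drift
  inequality without conditional expectations of \<open>V\<close>. The whole space gives the
  recursion of the means, the survival events feed the maximal inequality.\<close>

lemma integral_V_Suc_le:
  assumes m: "regular m" and A: "A \<in> sets (G (m * h))"
  shows "(\<integral>\<omega>. indicator A \<omega> * V (Suc m) \<omega> \<partial>M)
    \<le> (1 - a m * lam + CE * a m * \<theta> m) * (\<integral>\<omega>. indicator A \<omega> * V m \<omega> \<partial>M) + \<gamma> m"
proof -
  interpret G: finite_measure_subalgebra M "G (m * h)" by (rule finite_measure_subalgebra_G)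
  have AM[measurable]: "A \<in> sets M" using A subalgebra_G[of "m * h"] by (auto simp: subalgebra_def)
  \<comment> \<open>Putting the indicator into the state restricts all quadratic and linear terms to
    \<open>A\<close> at once. \<open>z\<close> remains measurable for the past of the block, hence
    for \<open>G (m * h + k)\<close> at each noise term of the block.\<close>
  define z where "z \<omega> = indicat_real A \<omega> *\<^sub>R e (m * h) \<omega>" for \<omega>
  have zG: "z \<in> borel_measurable (G (m * h))"
    unfolding z_def[abs_def] using A e_adapted[of "m * h"] by measurable
  have zG': "z \<in> borel_measurable (G (m * h + k))" for k
    by (rule measurable_from_subalg[OF subalgebra_G_mono zG]) simp
  have z_eq: "z \<omega> = (if \<omega> \<in> A then e (m * h) \<omega> else 0)" for \<omega> by (simp add: z_def indicator_def)
  have IV: "indicator A \<omega> * V m \<omega> = (norm (z \<omega>))\<^sup>2" for \<omega> by (simp add: z_eq V_def indicator_def)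
  have intIV: "integrable M (\<lambda>\<omega>. indicator A \<omega> * V k \<omega>)" for k
    using integrable_mult_indicator[OF AM integrable_V[of k]] by simp
  have z2: "integrable M (\<lambda>\<omega>. (norm (z \<omega>))\<^sup>2)" using intIV[of m] unfolding IV .
  have bddQ: "AE \<omega> in M. mnorm (Q (m * h + k) \<omega>) \<le> \<pi>1" for k using Q_bdd by eventually_elim simp
  have "(\<Sum>t\<in>{m*h..<(m+1)*h}. f t) = (\<Sum>k<h. f (m * h + k))" for f :: "nat \<Rightarrow> real^'q^'q"
    using sum.shift_bounds_nat_ivl[of f 0 "m * h" h] by (simp add: lessThan_atLeast0 add.commute)
  with Q_neg[of m] have neg: "AE \<omega> in M. lambda_max (\<Sum>k<h.
      cond_exp_mat M (G (m * h)) (\<lambda>x. Q (m * h + k) x + transpose (Q (m * h + k) x)) \<omega>) \<le> - lam"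
    by (simp add: G_def)
  note zQ = G.integral_quadratic_form_le[OF zG z2 meas_Q bddQ neg]
  have zE: "integrable M (\<lambda>\<omega>. z \<omega> \<bullet> E1 (m * h + k) \<omega>)" "(\<integral>\<omega>. z \<omega> \<bullet> E1 (m * h + k) \<omega> \<partial>M) = 0" for k
  proof -
    interpret Gk: finite_measure_subalgebra M "G (m * h + k)" by (rule finite_measure_subalgebra_G)
    have "AE \<omega> in M. cond_exp_vec M (G (m * h + k)) (E1 (m * h + k)) \<omega> = 0"
      using E1_mds unfolding G_def .
    from Gk.integral_inner_eq_0_of_cond_exp[OF zG' z2 meas_E1 integrable_E1 this]
    show "integrable M (\<lambda>\<omega>. z \<omega> \<bullet> E1 (m * h + k) \<omega>)" "(\<integral>\<omega>. z \<omega> \<bullet> E1 (m * h + k) \<omega> \<partial>M) = 0" .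
  qed
  let ?S = "\<lambda>\<omega>. z \<omega> \<bullet> (\<Sum>k<h. Q (m * h + k) \<omega> *v z \<omega>)"
  let ?T = "\<lambda>\<omega>. \<Sum>k<h. \<alpha> (m * h + k) * (z \<omega> \<bullet> E1 (m * h + k) \<omega>)"
  let ?B = "\<lambda>\<omega>. (1 + CE * a m * \<theta> m) * (norm (z \<omega>))\<^sup>2 + 2 * a m * ?S \<omega> + 2 * ?T \<omega>
    + CE * real h * N m \<omega> + CE * a m * \<rho> m"
  have intT: "integrable M ?T" by (intro Bochner_Integration.integrable_sum integrable_mult_right zE)
  have T0: "(\<integral>\<omega>. ?T \<omega> \<partial>M) = 0" by (simp add: Bochner_Integration.integral_sum zE)
  have "(\<integral>\<omega>. indicator A \<omega> * V (Suc m) \<omega> \<partial>M) \<le> (\<integral>\<omega>. ?B \<omega> \<partial>M)"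
  proof (rule integral_mono_AE[OF intIV])
    show "integrable M ?B"
      by (intro Bochner_Integration.integrable_add integrable_mult_right z2 zQ(1) intT integrable_N) simp
    show "AE \<omega> in M. indicator A \<omega> * V (Suc m) \<omega> \<le> ?B \<omega>"
      using AE_bounded_path
    proof eventually_elim
      case (elim \<omega>)
      show ?case
      proof (cases "\<omega> \<in> A")
        case True
        then show ?thesis using V_Suc_le[OF elim m] by (simp add: z_eq V_def algebra_simps)
      next
        case False
        \<comment> \<open>Outside \<open>A\<close> every term containing \<open>z\<close> vanishes
          and the left side is 0, so only nonnegative errors remain on the right.\<close>
        have "0 \<le> CE * real h * N m \<omega>" "0 \<le> CE * a m * \<rho> m"
          using CE_nonneg N_nonneg \<rho>_nonneg a_pos[of m] by simp_all
        then show ?thesis using False by (simp add: z_eq)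
      qed
    qed
  qed
  also have "\<dots> = (1 + CE * a m * \<theta> m) * (\<integral>\<omega>. (norm (z \<omega>))\<^sup>2 \<partial>M) + 2 * a m * (\<integral>\<omega>. ?S \<omega> \<partial>M)
      + CE * real h * (\<integral>\<omega>. N m \<omega> \<partial>M) + CE * a m * \<rho> m"
    by (simp add: Bochner_Integration.integral_add Bochner_Integration.integrable_add
        integrable_mult_right z2 zQ(1) intT T0 integrable_N prob_space)
  also have "\<dots> \<le> (1 + CE * a m * \<theta> m) * (\<integral>\<omega>. (norm (z \<omega>))\<^sup>2 \<partial>M)
      + a m * (- lam * (\<integral>\<omega>. (norm (z \<omega>))\<^sup>2 \<partial>M)) + CE * real h * (c\<epsilon> * \<nu> m) + CE * a m * \<rho> m"
  proof (intro add_mono order.refl)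
    show "2 * a m * (\<integral>\<omega>. ?S \<omega> \<partial>M) \<le> a m * (- lam * (\<integral>\<omega>. (norm (z \<omega>))\<^sup>2 \<partial>M))"
      using mult_left_mono[OF zQ(2), of "a m"] a_pos[of m] by simp
    show "CE * real h * (\<integral>\<omega>. N m \<omega> \<partial>M) \<le> CE * real h * (c\<epsilon> * \<nu> m)"
      using CE_nonneg by (intro mult_left_mono integral_N_le) simp
  qed
  also have "\<dots> = (1 - a m * lam + CE * a m * \<theta> m) * (\<integral>\<omega>. (norm (z \<omega>))\<^sup>2 \<partial>M) + \<gamma> m"
    by (simp add: \<gamma>_def algebra_simps)
  finally show ?thesis unfolding IV .
qed

text \<open>Half of the drift \<open>lam\<close> is spent on absorbing the error
  \<open>CE * \<theta> m\<close>, which tends to 0.\<close>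

lemma eventually_contraction:
  "\<forall>\<^sub>F m in sequentially. \<forall>A\<in>sets (G (m * h)). (\<integral>\<omega>. indicator A \<omega> * V (Suc m) \<omega> \<partial>M)
    \<le> (1 - a m * (lam / 2)) * (\<integral>\<omega>. indicator A \<omega> * V m \<omega> \<partial>M) + \<gamma> m"
proof -
  have "(\<lambda>m. CE * \<theta> m) \<longlonglongrightarrow> 0" using \<theta>_tendsto by (rule tendsto_mult_right_zero)
  then have "\<forall>\<^sub>F m in sequentially. CE * \<theta> m < lam / 2"
    using lam_pos by (intro order_tendstoD(2)[of _ 0]) auto
  with eventually_regular show ?thesis
  proof eventually_elim
    case (elim m)
    show ?case
    proof
      fix A assume A: "A \<in> sets (G (m * h))"
      have "a m * (CE * \<theta> m) \<le> a m * (lam / 2)" using elim a_pos[of m] by (intro mult_left_mono) auto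
      then have "1 - a m * lam + CE * a m * \<theta> m \<le> 1 - a m * (lam / 2)" by (simp add: algebra_simps)
      moreover have "0 \<le> (\<integral>\<omega>. indicator A \<omega> * V m \<omega> \<partial>M)"
        by (intro integral_nonneg_AE AE_I2) (simp add: V_def)
      ultimately have "(1 - a m * lam + CE * a m * \<theta> m) * (\<integral>\<omega>. indicator A \<omega> * V m \<omega> \<partial>M)
          \<le> (1 - a m * (lam / 2)) * (\<integral>\<omega>. indicator A \<omega> * V m \<omega> \<partial>M)"
        by (rule mult_right_mono)
      with integral_V_Suc_le[OF elim(1) A]
      show "(\<integral>\<omega>. indicator A \<omega> * V (Suc m) \<omega> \<partial>M)
          \<le> (1 - a m * (lam / 2)) * (\<integral>\<omega>. indicator A \<omega> * V m \<omega> \<partial>M) + \<gamma> m" by linarith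
    qed
  qed
qed

lemma integral_V_tendsto_0: "(\<lambda>m. \<integral>\<omega>. V m \<omega> \<partial>M) \<longlonglongrightarrow> 0"
proof (rule damped_recursion_tendsto_0)
  let ?b = "\<lambda>m. a m * (lam / 2)"
  show "0 \<le> (\<integral>\<omega>. V m \<omega> \<partial>M)" for m by (intro integral_nonneg_AE AE_I2) (simp add: V_def)
  show "0 \<le> ?b m" for m using a_pos[of m] lam_pos by simp
  have "?b \<longlonglongrightarrow> 0" using a_tendsto by (rule tendsto_mult_left_zero)
  then have "\<forall>\<^sub>F m in sequentially. ?b m < 1" by (rule order_tendstoD(2)) simp
  then show "\<forall>\<^sub>F m in sequentially. ?b m \<le> 1" by eventually_elim simp
  show "\<not> summable ?b"
  proof
    assume "summable ?b"
    then have "summable (\<lambda>m. ?b m * (2 / lam))" by (rule summable_mult2)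
    then show False using a_not_summable lam_pos by simp
  qed
  \<comment> \<open>The additive error relative to the damping, \<open>\<gamma> m / ?b m\<close>,
    reduces to \<open>\<nu> m / a m\<close> and \<open>\<rho> m\<close>, both of which tend to
    0.\<close>
  have "(\<lambda>m. 2 / lam * (CE * (real h * c\<epsilon> * (\<nu> m / a m) + \<rho> m))) \<longlonglongrightarrow> 2 / lam * (CE * (real h * c\<epsilon> * 0 + 0))"
    by (intro tendsto_intros \<nu>_div_a_tendsto \<rho>_tendsto)
  moreover have "2 / lam * (CE * (real h * c\<epsilon> * (\<nu> m / a m) + \<rho> m)) = \<gamma> m / ?b m" for m
    using a_pos[of m] lam_pos by (simp add: \<gamma>_def field_simps)
  ultimately show "(\<lambda>m. \<gamma> m / ?b m) \<longlonglongrightarrow> 0" by simp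
  show "\<forall>\<^sub>F m in sequentially. (\<integral>\<omega>. V (Suc m) \<omega> \<partial>M) \<le> (1 - ?b m) * (\<integral>\<omega>. V m \<omega> \<partial>M) + ?b m * (\<gamma> m / ?b m)"
    using eventually_contraction
  proof eventually_elim
    case (elim m)
    have "space M \<in> sets (G (m * h))"
      using sets.top[of "G (m * h)"] subalgebra_G[of "m * h"] unfolding subalgebra_def by metis
    with elim have "(\<integral>\<omega>. indicator (space M) \<omega> * V (Suc m) \<omega> \<partial>M)
      \<le> (1 - ?b m) * (\<integral>\<omega>. indicator (space M) \<omega> * V m \<omega> \<partial>M) + \<gamma> m" by blast
    moreover have "(\<integral>\<omega>. indicator (space M) \<omega> * V k \<omega> \<partial>M) = (\<integral>\<omega>. V k \<omega> \<partial>M)" for k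
      by (intro Bochner_Integration.integral_cong) auto
    moreover have "?b m \<noteq> 0" using a_pos[of m] lam_pos by simp
    ultimately show ?case by simp
  qed
qed

lemma mod_div_index: "t div h * h + t mod h = t" "t mod h \<le> h"
  using h_pos by (auto simp: less_imp_le)

theorem mean_square_convergence: "(\<lambda>t. \<integral>\<^sup>+ \<omega>. ennreal ((norm (e t \<omega>))\<^sup>2) \<partial>M) \<longlonglongrightarrow> 0"
proof -
  \<comment> \<open>\<open>Z m\<close> bounds the mean square at every time of block
    \<open>m\<close>; evaluated at \<open>t div h\<close> it dominates the mean square at time
    \<open>t\<close>.\<close>
  define Z where "Z m = CG * ((\<integral>\<omega>. V m \<omega> \<partial>M) + real h * (c\<epsilon> * \<nu> m) + a m * \<rho> m)" for m
  have "Z \<longlonglongrightarrow> CG * (0 + real h * (c\<epsilon> * 0) + 0 * 0)"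
    unfolding Z_def by (intro tendsto_intros integral_V_tendsto_0 \<nu>_tendsto a_tendsto \<rho>_tendsto)
  then have Z: "(\<lambda>t. Z (t div h)) \<longlonglongrightarrow> 0" using h_pos by (intro tendsto_block_quotient) auto
  have "(\<lambda>t. \<integral>\<omega>. (norm (e t \<omega>))\<^sup>2 \<partial>M) \<longlonglongrightarrow> 0"
  proof (rule tendsto_sandwich[OF _ _ tendsto_const Z])
    show "\<forall>\<^sub>F t in sequentially. 0 \<le> (\<integral>\<omega>. (norm (e t \<omega>))\<^sup>2 \<partial>M)" by simp
    have "\<forall>\<^sub>F t in sequentially. regular (t div h)"
    proof -
      obtain m0 where m0: "\<And>m. m \<ge> m0 \<Longrightarrow> regular m"
        using eventually_regular by (auto simp: eventually_sequentially)
      have "\<forall>t\<ge>m0 * h. regular (t div h)"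
        using h_pos by (auto intro!: m0 simp: less_eq_div_iff_mult_less_eq)
      then show ?thesis unfolding eventually_sequentially by blast
    qed
    then show "\<forall>\<^sub>F t in sequentially. (\<integral>\<omega>. (norm (e t \<omega>))\<^sup>2 \<partial>M) \<le> Z (t div h)"
    proof eventually_elim
      case (elim t)
      let ?m = "t div h"
      have "(\<integral>\<omega>. (norm (e t \<omega>))\<^sup>2 \<partial>M) \<le> (\<integral>\<omega>. CG * (V ?m \<omega> + real h * N ?m \<omega> + a ?m * \<rho> ?m) \<partial>M)"
      proof (rule integral_mono_AE[OF integrable_e])
        show "integrable M (\<lambda>\<omega>. CG * (V ?m \<omega> + real h * N ?m \<omega> + a ?m * \<rho> ?m))"
          by (intro Bochner_Integration.integrable_add integrable_mult_right integrable_V integrable_N) simp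
        show "AE \<omega> in M. (norm (e t \<omega>))\<^sup>2 \<le> CG * (V ?m \<omega> + real h * N ?m \<omega> + a ?m * \<rho> ?m)"
          using AE_bounded_path
          by eventually_elim (use norm_e_block_le[OF _ elim mod_div_index(2)[of t]] in \<open>simp add: mod_div_index\<close>)
      qed
      also have "\<dots> = CG * ((\<integral>\<omega>. V ?m \<omega> \<partial>M) + real h * (\<integral>\<omega>. N ?m \<omega> \<partial>M) + a ?m * \<rho> ?m)"
        by (simp add: Bochner_Integration.integral_add Bochner_Integration.integrable_add
            integrable_mult_right integrable_V integrable_N prob_space)
      also have "\<dots> \<le> Z ?m"
        unfolding Z_def using CG_nonneg
        by (intro mult_left_mono add_mono order.refl integral_N_le) auto
      finally show ?case .
    qed
  qed
  then have "(\<lambda>t. ennreal (\<integral>\<omega>. (norm (e t \<omega>))\<^sup>2 \<partial>M)) \<longlonglongrightarrow> ennreal 0" by (rule tendsto_ennrealI)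
  then show ?thesis by (simp add: nn_integral_eq_integral integrable_e)
qed

section \<open>Almost sure convergence\<close>

lemma summable_\<gamma>:
  assumes "summable (\<lambda>t. \<alpha> t powr (2 * (1 - \<delta>)))" and "summable (\<lambda>t. \<alpha> t * g2 t)"
  shows "summable \<gamma>"
proof -
  have \<nu>: "summable \<nu>"
    unfolding \<nu>_def by (subst summable_blocks[of "\<lambda>t. \<alpha> t powr (2 * (1 - \<delta>))"]) (use assms h_pos in auto)
  have blk: "summable (\<lambda>m. \<Sum>k<h. \<alpha> (m * h + k) * g2 (m * h + k))"
    by (subst summable_blocks[of "\<lambda>t. \<alpha> t * g2 t"])
       (use assms h_pos \<alpha>_pos g2_nonneg in \<open>auto simp: less_imp_le\<close>)
  \<comment> \<open>In a regular block \<open>a m\<close> is at most twice each of its step sizes,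
    so \<open>a m * \<rho> m\<close> is controlled by the block sum of
    \<open>\<alpha> t * g2 t\<close>.\<close>
  have "summable (\<lambda>m. a m * \<rho> m)"
  proof (rule summable_comparison_test_ev[OF _ summable_mult[OF blk, of 2]])
    show "\<forall>\<^sub>F m in sequentially. norm (a m * \<rho> m) \<le> 2 * (\<Sum>k<h. \<alpha> (m * h + k) * g2 (m * h + k))"
      using eventually_regular
    proof eventually_elim
      case (elim m)
      have "a m * \<rho> m \<le> (\<Sum>k<h. 2 * \<alpha> (m * h + k) * g2 (m * h + k))"
        unfolding \<rho>_def sum_distrib_left using step_le(2)[OF elim] g2_nonneg
        by (intro sum_mono mult_right_mono) auto
      then show ?case using a_pos[of m] \<rho>_nonneg[of m] by (simp add: sum_distrib_left mult.assoc)
    qed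
  qed
  with \<nu> show ?thesis unfolding \<gamma>_def by (intro summable_mult summable_add)
qed

text \<open>The expectations of the squared noise increments are summable, so the increments
  themselves are almost surely summable and tend to 0.\<close>

lemma AE_N_tendsto_0:
  assumes "summable (\<lambda>t. \<alpha> t powr (2 * (1 - \<delta>)))"
  shows "AE \<omega> in M. (\<lambda>m. N m \<omega>) \<longlonglongrightarrow> 0"
proof -
  let ?f = "\<lambda>t \<omega>. (\<alpha> t)\<^sup>2 * (norm (E1 t \<omega>))\<^sup>2"
  have "(\<integral>\<^sup>+\<omega>. (\<Sum>t. ennreal (?f t \<omega>)) \<partial>M) = (\<Sum>t. \<integral>\<^sup>+\<omega>. ennreal (?f t \<omega>) \<partial>M)"
    by (rule nn_integral_suminf) measurable
  also have "\<dots> \<le> (\<Sum>t. ennreal (c\<epsilon> * \<alpha> t powr (2 * (1 - \<delta>))))"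
  proof (intro suminf_le)
    fix t
    have "(\<integral>\<^sup>+\<omega>. ennreal (?f t \<omega>) \<partial>M) = ennreal (\<integral>\<omega>. ?f t \<omega> \<partial>M)"
      by (intro nn_integral_eq_integral integrable_mult_right integrable_E1) simp
    then show "(\<integral>\<^sup>+\<omega>. ennreal (?f t \<omega>) \<partial>M) \<le> ennreal (c\<epsilon> * \<alpha> t powr (2 * (1 - \<delta>)))"
      using integral_E1_le[of t] by (simp add: ennreal_leI)
  qed auto
  also have "\<dots> < \<infinity>"
    using c\<epsilon> by (subst suminf_ennreal2[OF _ summable_mult[OF assms]]) auto
  finally have "AE \<omega> in M. (\<Sum>t. ennreal (?f t \<omega>)) \<noteq> \<infinity>"
    by (intro nn_integral_noteq_infinite) auto
  then show ?thesis
  proof eventually_elim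
    case (elim \<omega>)
    then have "summable (\<lambda>t. ?f t \<omega>)" by (intro summable_suminf_not_top) auto
    then have "(\<lambda>t. ?f t \<omega>) \<longlonglongrightarrow> 0" by (rule summable_LIMSEQ_zero)
    then have "(\<lambda>m. ?f (m * h + k) \<omega>) \<longlonglongrightarrow> 0" for k by (rule tendsto_block_index) (rule h_pos)
    then show ?case unfolding N_def by (intro tendsto_null_sum)
  qed
qed

text \<open>The contraction yields the almost supermartingale inequality along block starts when its
  nonnegative damping term is dropped. The limit of the means comes from the mean square part, and
  \<open>norm_e_block_le\<close> fills in the times inside the blocks.\<close>

theorem almost_sure_convergence:
  assumes "summable (\<lambda>t. \<alpha> t powr (2 * (1 - \<delta>)))" and "summable (\<lambda>t. \<alpha> t * g2 t)"
  shows "AE \<omega> in M. (\<lambda>t. e t \<omega>) \<longlonglongrightarrow> 0"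
proof -
  obtain m0 where contr: "\<And>m A. m \<ge> m0 \<Longrightarrow> A \<in> sets (G (m * h)) \<Longrightarrow> (\<integral>\<omega>. indicator A \<omega> * V (Suc m) \<omega> \<partial>M)
    \<le> (1 - a m * (lam / 2)) * (\<integral>\<omega>. indicator A \<omega> * V m \<omega> \<partial>M) + \<gamma> m"
    using eventually_contraction unfolding eventually_sequentially by blast
  have "AE \<omega> in M. (\<lambda>m. V m \<omega>) \<longlonglongrightarrow> 0"
  proof (rule almost_supermartingale_AE_tendsto_0[where G = "\<lambda>m. G (m * h)"])
    show "subalgebra M (G (m * h))" for m by (rule subalgebra_G)
    show "sets (G (m * h)) \<subseteq> sets (G (Suc m * h))" for m
      using subalgebra_G_mono[of "m * h" "Suc m * h"] by (simp add: subalgebra_def)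
    show "V m \<in> borel_measurable (G (m * h))" for m
      unfolding V_def[abs_def] using e_adapted[of "m * h"] by measurable
    show "0 \<le> V m \<omega>" for m \<omega> by (simp add: V_def)
    show "integrable M (V m)" for m by (rule integrable_V)
    show "summable \<gamma>" by (rule summable_\<gamma>[OF assms])
    show "0 \<le> \<gamma> m" for m by (rule \<gamma>_nonneg)
    show "(\<lambda>m. \<integral>\<omega>. V m \<omega> \<partial>M) \<longlonglongrightarrow> 0" by (rule integral_V_tendsto_0)
    fix m A assume *: "m \<ge> m0" "A \<in> sets (G (m * h))"
    have "0 \<le> (\<integral>\<omega>. indicator A \<omega> * V m \<omega> \<partial>M)"
      by (intro integral_nonneg_AE AE_I2) (simp add: V_def)
    then have "0 \<le> a m * (lam / 2) * (\<integral>\<omega>. indicator A \<omega> * V m \<omega> \<partial>M)"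
      using a_pos[of m] lam_pos by simp
    then show "(\<integral>\<omega>. indicator A \<omega> * V (Suc m) \<omega> \<partial>M) \<le> (\<integral>\<omega>. indicator A \<omega> * V m \<omega> \<partial>M) + \<gamma> m"
      using contr[OF *] by (simp add: left_diff_distrib)
  qed
  with AE_N_tendsto_0[OF assms(1)] AE_bounded_path show ?thesis
  proof eventually_elim
    case (elim \<omega>)
    define Z where "Z m = CG * (V m \<omega> + real h * N m \<omega> + a m * \<rho> m)" for m
    have "Z \<longlonglongrightarrow> CG * (0 + real h * 0 + 0 * 0)"
      unfolding Z_def by (intro tendsto_intros elim a_tendsto \<rho>_tendsto)
    then have Z: "(\<lambda>t. Z (t div h)) \<longlonglongrightarrow> 0" using h_pos by (intro tendsto_block_quotient) auto
    obtain m1 where m1: "\<And>m. m \<ge> m1 \<Longrightarrow> regular m"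
      using eventually_regular by (auto simp: eventually_sequentially)
    have "(\<lambda>t. (norm (e t \<omega>))\<^sup>2) \<longlonglongrightarrow> 0"
    proof (rule tendsto_sandwich[OF _ _ tendsto_const Z])
      have "\<forall>t\<ge>m1 * h. (norm (e t \<omega>))\<^sup>2 \<le> Z (t div h)"
      proof (intro allI impI)
        fix t assume "t \<ge> m1 * h"
        then have "regular (t div h)" using h_pos by (intro m1) (simp add: less_eq_div_iff_mult_less_eq)
        from norm_e_block_le[OF elim(2) this mod_div_index(2)[of t]]
        show "(norm (e t \<omega>))\<^sup>2 \<le> Z (t div h)" by (simp add: mod_div_index Z_def)
      qed
      then show "\<forall>\<^sub>F t in sequentially. (norm (e t \<omega>))\<^sup>2 \<le> Z (t div h)"
        unfolding eventually_sequentially by blast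
    qed simp
    from tendsto_real_sqrt[OF this] show ?case by (simp add: tendsto_norm_zero_iff)
  qed
qed

end

theorem theorem4:
  fixes M :: "'a measure"
    and Q D :: "nat \<Rightarrow> 'a \<Rightarrow> real^'q^'q"
    and E1 E2 e :: "nat \<Rightarrow> 'a \<Rightarrow> real^'q"
    and \<alpha> g1 g2 :: "nat \<Rightarrow> real"
    and e0 :: "real^'q"
    and \<alpha>0 \<pi>1 lam c\<epsilon> \<delta> :: real and h :: nat
  defines "F \<equiv> filtr M Q D E1"
  assumes prob: "prob_space M"
    and meas_Q: "\<And>t. Q t \<in> borel_measurable M"
    and meas_D: "\<And>t. D t \<in> borel_measurable M"
    and meas_E1: "\<And>t. E1 t \<in> borel_measurable M"
    and e_0: "\<And>\<omega>. e 0 \<omega> = e0"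
    and e_Suc: "\<And>t \<omega>. e (Suc t) \<omega> = e t \<omega> + \<alpha> t *\<^sub>R ((Q t \<omega> + D t \<omega>) *v e t \<omega>)
                                     + \<alpha> t *\<^sub>R (E1 t \<omega> + E2 t \<omega>)"
    \<comment> \<open>Assumption 3 (i)\<close>
    and \<alpha>_pos: "\<And>t. \<alpha> t > 0"
    and \<alpha>_lim: "\<alpha> \<longlonglongrightarrow> 0"
    and \<alpha>_nsum: "\<not> summable \<alpha>"
    and \<alpha>0: "\<alpha>0 \<ge> 0"
    and \<alpha>_inv: "(\<lambda>t. 1 / \<alpha> (Suc t) - 1 / \<alpha> t) \<longlonglongrightarrow> \<alpha>0"
    \<comment> \<open>Assumption 3 (ii.a)\<close>
    and Q_bdd: "AE \<omega> in M. \<forall>t. mnorm (Q t \<omega>) \<le> \<pi>1"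
    and h_pos: "h > 0" and lam_pos: "lam > 0"
    and Q_neg: "\<And>m. AE \<omega> in M.
        lambda_max (\<Sum>t\<in>{m*h..<(m+1)*h}.
           cond_exp_mat M (F (int (m*h) - 1)) (\<lambda>x. Q t x + transpose (Q t x)) \<omega>) \<le> - lam"
    \<comment> \<open>Assumption 3 (ii.b)\<close>
    and D_bdd: "\<And>t. AE \<omega> in M. mnorm (D t \<omega>) \<le> g1 t"
    and g1_lim: "g1 \<longlonglongrightarrow> 0" and g1_bdd: "bdd_above (range g1)"
    \<comment> \<open>Assumption 3 (iii.a)\<close>
    and E1_int: "\<And>t i. integrable M (\<lambda>\<omega>. E1 t \<omega> $ i)"
    and E1_mds: "\<And>t. AE \<omega> in M. cond_exp_vec M (F (int t - 1)) (E1 t) \<omega> = 0"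
    and \<delta>: "0 \<le> \<delta>" "\<delta> < 1/2" and c\<epsilon>: "c\<epsilon> > 0"
    and E1_var: "\<And>t. AE \<omega> in M.
        nn_cond_exp M (F (int t - 1)) (\<lambda>x. ennreal ((norm (\<alpha> t powr \<delta> *\<^sub>R E1 t x))\<^sup>2)) \<omega>
          \<le> ennreal c\<epsilon>"
    \<comment> \<open>Assumption 3 (iii.b)\<close>
    and meas_E2: "\<And>t. E2 t \<in> borel_measurable (F (int t))"
    and E2_bdd: "\<And>t. AE \<omega> in M. norm (E2 t \<omega>) \<le> g2 t"
    and g2_lim: "g2 \<longlonglongrightarrow> 0" and g2_bdd: "bdd_above (range g2)"
  shows "(\<lambda>t. \<integral>\<^sup>+ \<omega>. ennreal ((norm (e t \<omega>))\<^sup>2) \<partial>M) \<longlonglongrightarrow> 0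
       \<and> (\<forall>(u :: nat \<Rightarrow> 'a \<Rightarrow> real^'q^'q) (w :: nat \<Rightarrow> 'a \<Rightarrow> real^'q).
            summable (\<lambda>t. \<alpha> t powr (2 * (1 - \<delta>)))
          \<and> summable (\<lambda>t. \<alpha> t * g2 t)
          \<and> (\<forall>t. u t \<in> borel_measurable M)
          \<and> (\<forall>t. \<forall>\<omega>\<in>space M. E1 t \<omega> = u t \<omega> *v w t \<omega>)
          \<and> prob_space.indep_set M
               (sigma_sets (space M) (gen_events M w UNIV))
               (sigma_sets (space M) (gen_events M Q UNIV \<union> gen_events M D UNIV \<union> gen_events M u UNIV))
          \<and> (\<forall>t. w t \<in> borel_measurable (F (int t)))
          \<and> (\<forall>t i. integrable M (\<lambda>\<omega>. w t \<omega> $ i))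
          \<and> (\<forall>t. AE \<omega> in M. cond_exp_vec M (F (int t - 1)) (w t) \<omega> = 0)
          \<longrightarrow> (AE \<omega> in M. (\<lambda>t. e t \<omega>) \<longlonglongrightarrow> 0))"
proof -
  interpret prob_space M by (rule prob)
  interpret linear_recursion M Q D E1 E2 e \<alpha> g1 g2 e0 \<alpha>0 \<pi>1 lam c\<epsilon> \<delta> h
    by unfold_locales (fact assms[unfolded F_def])+
  show ?thesis using mean_square_convergence almost_sure_convergence by blast
qed

end
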